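(* Let $d\ge 1$ and let $p_1,\dots,p_d$ be distinct primes. Fix $\eta>0$. Then there exists a constant $C_\eta>0$ such that, for every $0<\delta\le\eta$, \[ \sup_{\boldsymbol\rho\in B_d}\left\|2\delta A_{\delta,\boldsymbol\rho}-\mathcal H_{\boldsymbol\rho}\right\|\le C_\eta\,\delta , \] where the norm is the operator norm on $\ell^2(\mathbb N_0^d)$. Consequently, for every $0<\delta\le\eta$, \[ \sup_{\boldsymbol\rho\in B_d}\left|2\delta\,\|C_{\varphi_{\delta,\boldsymbol\rho}}\|^2-\|\mathcal H_{\boldsymbol\rho}\|\right|\le C_\eta\,\delta . \]
   Context: $\mathcal H^2$ is the Hilbert space of Dirichlet series $f(s)=\sum_{n\ge1}a_nn^{-s}$ with $\|f\|^2=\sum_n|a_n|^2<\infty$; its elements are analytic on $\{\operatorname{Re}s>1/2\}$. The set $B_d=\{\boldsymbol\rho=(\rho_1,\dots,\rho_d)\in[0,1]^d:\rho_1+\cdots+\rho_d\le1\}$. For $\delta>0$, $\boldsymbol\rho\in B_d$, \[ \varphi_{\delta,\boldsymbol\rho}(s)=\tfrac12+\delta+\delta\sum_{j=1}^d\rho_jp_j^{-s}, \] which maps $\{\operatorname{Re}s>0\}$ into $\{\operatorname{Re}s>1/2\}$, and $C_{\varphi_{\delta,\boldsymbol\rho}}f=f\circ\varphi_{\delta,\boldsymbol\rho}$ is the induced composition operator on $\mathcal H^2$ (bounded, by the Gordon–Hedenmalm theorem). Multi-index notation: for $\alpha\in\mathbb N_0^d$, $|\alpha|=\sum_j\alpha_j$,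 $\alpha!=\prod_j\alpha_j!$, $\boldsymbol\rho^\alpha=\prod_j\rho_j^{\alpha_j}$, with $0^0=1$. The coefficient operator $T_{\delta,\boldsymbol\rho}:\ell^2(\mathbb N)\to\ell^2(\mathbb N_0^d)$ is the bounded operator \[ (T_{\delta,\boldsymbol\rho}a)_\alpha=\sum_{n=1}^\infty a_n n^{-1/2-\delta}\frac{(-\delta\log n)^{|\alpha|}\boldsymbol\rho^\alpha}{\alpha!}, \] and $A_{\delta,\boldsymbol\rho}=T_{\delta,\boldsymbol\rho}T_{\delta,\boldsymbol\rho}^*$. The operator $\mathcal H_{\boldsymbol\rho}$ is the bounded operator on $\ell^2(\mathbb N_0^d)$ with matrix entries \[ (\mathcal H_{\boldsymbol\rho})_{\alpha,\beta}=(-1)^{|\alpha|+|\beta|}\frac{(|\alpha|+|\beta|)!}{\alpha!\,\beta!}\prod_{j=1}^d\left(\frac{\rho_j}{2}\right)^{\alpha_j+\beta_j},\qquad \alpha,\beta\in\mathbb N_0^d. \] *)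

theory Defs
  imports "HOL-Analysis.Analysis" "HOL-Computational_Algebra.Primes"
begin

section \<open>The complex Hilbert space of square-summable families\<close>

typedef 'i ell2 = "{x :: 'i \<Rightarrow> complex. (\<lambda>i. (cmod (x i))\<^sup>2) summable_on UNIV}"
  morphisms coord Abs_ell2
  by (rule exI[of _ "\<lambda>_. 0"]) auto

setup_lifting type_definition_ell2

lemma ell2_summable_mult:
  fixes x y :: "'i \<Rightarrow> complex"
  assumes "(\<lambda>i. (cmod (x i))\<^sup>2) summable_on UNIV" "(\<lambda>i. (cmod (y i))\<^sup>2) summable_on UNIV"
  shows "(\<lambda>i. x i * cnj (y i)) summable_on UNIV"
proof -
  have s: "(\<lambda>i. (cmod (x i))\<^sup>2 + (cmod (y i))\<^sup>2) summable_on UNIV"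
    by (intro summable_on_add assms)
  have le: "norm (x i * cnj (y i)) \<le> (cmod (x i))\<^sup>2 + (cmod (y i))\<^sup>2" for i
  proof -
    have "2 * cmod (x i) * cmod (y i) \<le> (cmod (x i))\<^sup>2 + (cmod (y i))\<^sup>2"
      by (rule sum_squares_bound)
    moreover have "0 \<le> cmod (x i) * cmod (y i)" by simp
    ultimately show ?thesis unfolding norm_mult complex_mod_cnj by linarith
  qed
  have "(\<lambda>i. norm (x i * cnj (y i))) summable_on UNIV"
    by (rule Infinite_Sum.abs_summable_on_comparison_test'[OF s le])
  then show ?thesis by (rule abs_summable_summable)
qed

lemma ell2_summable_add:
  fixes x y :: "'i \<Rightarrow> complex"
  assumes "(\<lambda>i. (cmod (x i))\<^sup>2) summable_on UNIV" "(\<lambda>i. (cmod (y i))\<^sup>2) summable_on UNIV"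
  shows "(\<lambda>i. (cmod (x i + y i))\<^sup>2) summable_on UNIV"
proof -
  have s: "(\<lambda>i. 2 * (cmod (x i))\<^sup>2 + 2 * (cmod (y i))\<^sup>2) summable_on UNIV"
    by (intro summable_on_add summable_on_cmult_right assms)
  have "(cmod (x i + y i))\<^sup>2 \<le> 2 * (cmod (x i))\<^sup>2 + 2 * (cmod (y i))\<^sup>2" for i
  proof -
    have "(cmod (x i + y i))\<^sup>2 \<le> (cmod (x i) + cmod (y i))\<^sup>2"
      by (intro power_mono norm_triangle_ineq) simp
    also have "\<dots> \<le> 2 * (cmod (x i))\<^sup>2 + 2 * (cmod (y i))\<^sup>2"
      using sum_squares_bound[of "cmod (x i)" "cmod (y i)"] by (simp add: power2_sum)
    finally show ?thesis .
  qed
  then show ?thesis by (intro summable_on_comparison_test[OF s]) auto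
qed

definition cinner :: "'i ell2 \<Rightarrow> 'i ell2 \<Rightarrow> complex" where
  "cinner x y = (\<Sum>\<^sub>\<infinity>i. coord x i * cnj (coord y i))"

text \<open>The distribution has no class of complex inner product spaces, so the real part of
  \<^const>\<open>cinner\<close> is used to instantiate \<^class>\<open>real_inner\<close>.  The norm is the usual one
  (lemma \<open>ell2_norm\<close>), and the operator norm of a complex-linear map does not depend on
  whether the space is viewed over the reals or over the complex numbers.\<close>

instantiation ell2 :: (type) real_inner
begin

lift_definition zero_ell2 :: "'a ell2" is "\<lambda>_. 0" by simp

lift_definition plus_ell2 :: "'a ell2 \<Rightarrow> 'a ell2 \<Rightarrow> 'a ell2" is "\<lambda>x y i. x i + y i"
  by (rule ell2_summable_add)

lift_definition uminus_ell2 :: "'a ell2 \<Rightarrow> 'a ell2" is "\<lambda>x i. - x i" by simp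

lift_definition minus_ell2 :: "'a ell2 \<Rightarrow> 'a ell2 \<Rightarrow> 'a ell2" is "\<lambda>x y i. x i - y i"
proof -
  fix x y :: "'a \<Rightarrow> complex"
  assume "(\<lambda>i. (cmod (x i))\<^sup>2) summable_on UNIV" "(\<lambda>i. (cmod (y i))\<^sup>2) summable_on UNIV"
  then show "(\<lambda>i. (cmod (x i - y i))\<^sup>2) summable_on UNIV"
    using ell2_summable_add[of x "\<lambda>i. - y i"] by simp
qed

lift_definition scaleR_ell2 :: "real \<Rightarrow> 'a ell2 \<Rightarrow> 'a ell2" is "\<lambda>r x i. r *\<^sub>R x i"
  by (simp add: power_mult_distrib summable_on_cmult_right)

definition inner_ell2 :: "'a ell2 \<Rightarrow> 'a ell2 \<Rightarrow> real" where
  "inner_ell2 x y = Re (cinner x y)"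

definition norm_ell2 :: "'a ell2 \<Rightarrow> real" where
  "norm_ell2 x = sqrt (inner x x)"

definition sgn_ell2 :: "'a ell2 \<Rightarrow> 'a ell2" where
  "sgn_ell2 x = inverse (norm x) *\<^sub>R x"

definition dist_ell2 :: "'a ell2 \<Rightarrow> 'a ell2 \<Rightarrow> real" where
  "dist_ell2 x y = norm (x - y)"

definition uniformity_ell2 :: "('a ell2 \<times> 'a ell2) filter" where
  "uniformity_ell2 = (INF e\<in>{0<..}. principal {(x, y). dist x y < e})"

definition open_ell2 :: "'a ell2 set \<Rightarrow> bool" where
  "open_ell2 S = (\<forall>x\<in>S. \<forall>\<^sub>F (x', y) in uniformity. x' = x \<longrightarrow> y \<in> S)"

instance
proof
  fix x y z :: "'a ell2" and r s :: real
  have summ: "(\<lambda>i. coord u i * cnj (coord v i)) summable_on UNIV" for u v :: "'a ell2"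
    using coord[of u] coord[of v] by (intro ell2_summable_mult) auto
  have self: "inner u u = (\<Sum>\<^sub>\<infinity>i. (cmod (coord u i))\<^sup>2)" for u :: "'a ell2"
    unfolding inner_ell2_def cinner_def infsum_Re[OF summ, symmetric]
    by (simp add: complex_mult_cnj cmod_power2)
  show "x + y + z = x + (y + z)" "x + y = y + x" "0 + x = x" "- x + x = 0" "x - y = x + - y"
    "r *\<^sub>R (x + y) = r *\<^sub>R x + r *\<^sub>R y" "(r + s) *\<^sub>R x = r *\<^sub>R x + s *\<^sub>R x"
    "r *\<^sub>R s *\<^sub>R x = (r * s) *\<^sub>R x" "1 *\<^sub>R x = x"
    by (transfer; simp add: fun_eq_iff algebra_simps)+
  show "sgn x = inverse (norm x) *\<^sub>R x" by (rule sgn_ell2_def)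
  show "dist x y = norm (x - y)" by (rule dist_ell2_def)
  show "uniformity = (INF e\<in>{0<..}. principal {(x :: 'a ell2, y). dist x y < e})"
    by (rule uniformity_ell2_def)
  show "open U = (\<forall>x\<in>U. \<forall>\<^sub>F (x', y) in uniformity. x' = x \<longrightarrow> y \<in> U)" for U :: "'a ell2 set"
    by (rule open_ell2_def)
  show "norm x = sqrt (inner x x)" by (rule norm_ell2_def)
  show "inner x y = inner y x"
    unfolding inner_ell2_def cinner_def infsum_Re[OF summ, symmetric]
    by (simp add: mult.commute)
  show "inner (x + y) z = inner x z + inner y z"
    unfolding inner_ell2_def cinner_def
    by (simp add: plus_ell2.rep_eq distrib_right infsum_add summ)
  show "inner (r *\<^sub>R x) y = r * inner x y"
    unfolding inner_ell2_def cinner_def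
    by (simp add: scaleR_ell2.rep_eq infsum_scaleR_right)
  show "0 \<le> inner x x" unfolding self by (intro infsum_nonneg) simp
  show "inner x x = 0 \<longleftrightarrow> x = 0"
  proof
    assume "inner x x = 0"
    then have "(cmod (coord x i))\<^sup>2 = 0" for i
      using coord[of x] unfolding self
      by (intro nonneg_infsum_le_0D[where A = UNIV and f = "\<lambda>i. (cmod (coord x i))\<^sup>2"]) auto
    then show "x = 0" by (simp add: coord_inject[symmetric] zero_ell2.rep_eq fun_eq_iff)
  qed (simp add: self zero_ell2.rep_eq)
qed

end

lemma ell2_norm: "norm x = sqrt (\<Sum>\<^sub>\<infinity>i. (cmod (coord x i))\<^sup>2)"
proof -
  have "(\<lambda>i. coord x i * cnj (coord x i)) summable_on UNIV"
    using coord[of x] by (intro ell2_summable_mult) auto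
  from infsum_Re[OF this] show ?thesis
    unfolding norm_ell2_def inner_ell2_def cinner_def
    by (simp add: complex_mult_cnj cmod_power2)
qed

text \<open>The Hilbert space adjoint, with respect to the complex inner product.\<close>

definition hilbert_adjoint :: "('i ell2 \<Rightarrow>\<^sub>L 'j ell2) \<Rightarrow> ('j ell2 \<Rightarrow>\<^sub>L 'i ell2)" where
  "hilbert_adjoint T = (THE S. \<forall>x y. cinner (blinfun_apply T x) y = cinner x (blinfun_apply S y))"

section \<open>Dirichlet series and composition operators\<close>

text \<open>An element \<open>f(s) = (\<Sum>n\<ge>1. a\<^sub>n n\<^sup>-\<^sup>s)\<close> of the Hardy space of Dirichlet series is
  represented by its coefficient sequence.  Since the library's \<^typ>\<open>nat\<close> starts at \<open>0\<close>,
  coordinate \<open>n\<close> of \<^typ>\<open>nat ell2\<close> is the coefficient \<open>a\<close> with index \<open>Suc n\<close>; the same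
  indexing is used for the sequence space over the positive integers.\<close>

type_synonym hardy_dirichlet = "nat ell2"

definition dirichlet_eval :: "hardy_dirichlet \<Rightarrow> complex \<Rightarrow> complex" where
  "dirichlet_eval f s = (\<Sum>n. coord f n * of_nat (Suc n) powr (- s))"

text \<open>Bounded operators given by a formula are introduced by definite description over
  the type of bounded linear maps, so that \<^const>\<open>norm\<close> is the genuine operator norm.
  Elements of the Hardy space are functions on the half-plane \<open>Re s > 1/2\<close>,
  so that is where \<open>C f = f \<circ> \<phi>\<close> is required.\<close>

definition composition_operator ::
    "(complex \<Rightarrow> complex) \<Rightarrow> (hardy_dirichlet \<Rightarrow>\<^sub>L hardy_dirichlet)" where
  "composition_operator \<phi> =
     (THE C. \<forall>f s. Re s > 1/2 \<longrightarrow> dirichlet_eval (blinfun_apply C f) s = dirichlet_eval f (\<phi> s))"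

section \<open>The symbols and the operators attached to them\<close>

definition B_set :: "(real^'d) set" where
  "B_set = {\<rho>. (\<forall>j. 0 \<le> \<rho> $ j \<and> \<rho> $ j \<le> 1) \<and> (\<Sum>j\<in>UNIV. \<rho> $ j) \<le> 1}"

definition symbol :: "('d::finite \<Rightarrow> nat) \<Rightarrow> real \<Rightarrow> real^'d \<Rightarrow> complex \<Rightarrow> complex" where
  "symbol p \<delta> \<rho> s = 1/2 + of_real \<delta>
     + of_real \<delta> * (\<Sum>j\<in>UNIV. of_real (\<rho> $ j) * of_nat (p j) powr (- s))"

type_synonym 'd multi_index = "'d \<Rightarrow> nat"

definition mi_abs :: "'d::finite multi_index \<Rightarrow> nat" where
  "mi_abs \<alpha> = (\<Sum>j\<in>UNIV. \<alpha> j)"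

definition mi_fact :: "'d::finite multi_index \<Rightarrow> real" where
  "mi_fact \<alpha> = (\<Prod>j\<in>UNIV. fact (\<alpha> j))"

definition mi_power :: "real^'d \<Rightarrow> 'd::finite multi_index \<Rightarrow> real" where
  "mi_power \<rho> \<alpha> = (\<Prod>j\<in>UNIV. (\<rho> $ j) ^ \<alpha> j)"

definition coeff_operator :: "real \<Rightarrow> real^'d \<Rightarrow> (nat ell2 \<Rightarrow>\<^sub>L 'd::finite multi_index ell2)" where
  "coeff_operator \<delta> \<rho> = (THE T. \<forall>a \<alpha>. coord (blinfun_apply T a) \<alpha> =
     (\<Sum>n. coord a n * of_real (real (Suc n) powr (- 1/2 - \<delta>)
        * ((- \<delta> * ln (real (Suc n))) ^ mi_abs \<alpha> * mi_power \<rho> \<alpha> / mi_fact \<alpha>))))"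

definition A_operator ::
    "real \<Rightarrow> real^'d \<Rightarrow> ('d::finite multi_index ell2 \<Rightarrow>\<^sub>L 'd multi_index ell2)" where
  "A_operator \<delta> \<rho> = coeff_operator \<delta> \<rho> o\<^sub>L hilbert_adjoint (coeff_operator \<delta> \<rho>)"

definition H_entry :: "real^'d \<Rightarrow> 'd::finite multi_index \<Rightarrow> 'd multi_index \<Rightarrow> real" where
  "H_entry \<rho> \<alpha> \<beta> = (-1) ^ (mi_abs \<alpha> + mi_abs \<beta>)
     * (fact (mi_abs \<alpha> + mi_abs \<beta>) / (mi_fact \<alpha> * mi_fact \<beta>))
     * (\<Prod>j\<in>UNIV. (\<rho> $ j / 2) ^ (\<alpha> j + \<beta> j))"

definition H_operator :: "real^'d \<Rightarrow> ('d::finite multi_index ell2 \<Rightarrow>\<^sub>L 'd multi_index ell2)" where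
  "H_operator \<rho> = (THE H. \<forall>x \<alpha>. coord (blinfun_apply H x) \<alpha> =
     (\<Sum>\<^sub>\<infinity>\<beta>. of_real (H_entry \<rho> \<alpha> \<beta>) * coord x \<beta>))"

end

theory Submission
  imports Defs
begin

text \<open>
  The entry of \<open>A\<close> at \<open>\<alpha>, \<beta>\<close> is \<open>(-\<delta>)\<^sup>m \<rho>\<^sup>\<alpha>\<^sup>+\<^sup>\<beta> / (\<alpha>! \<beta>!)\<close> times the sum of
  \<open>n\<^sup>-\<^sup>1\<^sup>-\<^sup>2\<^sup>\<delta> (ln n)\<^sup>m\<close>, where \<open>m = |\<alpha>| + |\<beta>|\<close>, and replacing the sum by the integral
  \<open>m! / (2\<delta>)\<^sup>m\<^sup>+\<^sup>1\<close> turns \<open>2\<delta>A\<close> into \<open>H\<close>.  The total variation of the integrand bounds the error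
  of this replacement by \<open>2 m! / (1 + 2\<delta>)\<^sup>m\<close>.  Hence the entries of \<open>2\<delta>A - H\<close> are at most
  \<open>4\<delta> q\<^sup>m m! \<rho>\<^sup>\<alpha>\<^sup>+\<^sup>\<beta> / (\<alpha>! \<beta>!)\<close> with \<open>q = \<delta> / (1 + 2\<delta>) \<le> 1/2\<close>; by the multinomial theorem and
  the negative binomial series each row sums to at most \<open>8\<delta>\<close>, so the Schur test gives
  the first estimate with \<open>C = 8\<close>.  For the second one, expanding
  \<open>n\<^sup>-\<^sup>\<phi>\<^sup>(\<^sup>s\<^sup>)\<close> into an exponential series in each \<open>p\<^sub>j\<^sup>-\<^sup>s\<close> shows that \<open>C\<^sub>\<phi> = V T\<close>, where \<open>V\<close> is the
  isometry sending the basis vector of index \<open>\<alpha>\<close> to the monomial of \<open>\<Prod>\<^sub>j p\<^sub>j\<^sup>\<alpha>\<^sup>j\<close>; thus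
  \<open>\<parallel>C\<^sub>\<phi>\<parallel>\<^sup>2 = \<parallel>T\<parallel>\<^sup>2 = \<parallel>A\<parallel>\<close>.
\<close>

section \<open>Operators on square-summable families given by kernels\<close>

lemma coord_cmod_summable: "(\<lambda>i. (cmod (coord x i))\<^sup>2) summable_on UNIV"
  using coord[of x] by simp

lemma ell2_eqI: "(\<And>i. coord x i = coord y i) \<Longrightarrow> x = y"
  by (simp add: coord_inject[symmetric] fun_eq_iff)

lemma L2_set_le_infsum:
  assumes "(\<lambda>i. (cmod (f i))\<^sup>2) summable_on UNIV" "finite F"
  shows "L2_set (\<lambda>i. cmod (f i)) F \<le> sqrt (\<Sum>\<^sub>\<infinity>i. (cmod (f i))\<^sup>2)"
  unfolding L2_set_def using assms by (intro real_sqrt_le_mono finite_sum_le_infsum) auto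

lemma L2_set_coord_le: "finite F \<Longrightarrow> L2_set (\<lambda>i. cmod (coord x i)) F \<le> norm x"
  unfolding ell2_norm by (rule L2_set_le_infsum[OF coord_cmod_summable])

text \<open>A uniform bound on finite sections gives both membership in the space and the bound on
  the norm, so that estimates need only be made on finite sets.\<close>

lemma square_summable_if_L2_set_le:
  assumes "\<And>F. finite F \<Longrightarrow> L2_set (\<lambda>i. cmod (f i)) F \<le> M"
  shows "(\<lambda>i. (cmod (f i))\<^sup>2) summable_on UNIV" "sqrt (\<Sum>\<^sub>\<infinity>i. (cmod (f i))\<^sup>2) \<le> M"
proof -
  have M: "0 \<le> M" using assms[of "{}"] by simp
  have fin: "(\<Sum>i\<in>F. (cmod (f i))\<^sup>2) \<le> M\<^sup>2" if "finite F" for F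
    using assms[OF that] unfolding L2_set_def by (rule sqrt_le_D)
  show s: "(\<lambda>i. (cmod (f i))\<^sup>2) summable_on UNIV"
    by (rule nonneg_bdd_above_summable_on) (auto intro!: bdd_aboveI[of _ "M\<^sup>2"] fin)
  have "(\<Sum>\<^sub>\<infinity>i. (cmod (f i))\<^sup>2) \<le> M\<^sup>2"
    by (rule infsum_le_finite_sums[OF s]) (rule fin)
  then show "sqrt (\<Sum>\<^sub>\<infinity>i. (cmod (f i))\<^sup>2) \<le> M" using M by (rule real_le_lsqrt[rotated])
qed

text \<open>The bound concerns the form with entries \<open>cmod (K i j)\<close>, which is stronger
  than boundedness of the operator itself. It makes the double sums below absolutely summable, which
  justifies their interchange. Finite index sets keep convergence out of the definition.\<close>

definition bounded_kernel :: "('i \<Rightarrow> 'j \<Rightarrow> complex) \<Rightarrow> real \<Rightarrow> bool" where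
  "bounded_kernel K M \<longleftrightarrow> 0 \<le> M \<and> (\<forall>F G x y. finite F \<longrightarrow> finite G \<longrightarrow>
     (\<Sum>i\<in>F. \<Sum>j\<in>G. cmod (K i j) * \<bar>x j\<bar> * \<bar>y i\<bar>) \<le> M * L2_set x G * L2_set y F)"

lemma bounded_kernelD:
  assumes "bounded_kernel K M" "finite F" "finite G"
  shows "(\<Sum>i\<in>F. \<Sum>j\<in>G. cmod (K i j) * \<bar>x j\<bar> * \<bar>y i\<bar>) \<le> M * L2_set x G * L2_set y F"
  using assms unfolding bounded_kernel_def by blast

lemma bounded_kernel_nonneg: "bounded_kernel K M \<Longrightarrow> 0 \<le> M"
  unfolding bounded_kernel_def by blast

lemma bounded_kernel_adjoint:
  fixes K :: "'i \<Rightarrow> 'j \<Rightarrow> complex"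
  assumes "bounded_kernel K M"
  shows "bounded_kernel (\<lambda>j i. cnj (K i j)) M"
  unfolding bounded_kernel_def
proof (intro conjI allI impI)
  show "0 \<le> M" using assms by (rule bounded_kernel_nonneg)
  fix F :: "'j set" and G :: "'i set" and x y assume "finite F" "finite G"
  from bounded_kernelD[OF assms this(2,1), of y x]
  show "(\<Sum>i\<in>F. \<Sum>j\<in>G. cmod (cnj (K j i)) * \<bar>x j\<bar> * \<bar>y i\<bar>) \<le> M * L2_set x G * L2_set y F"
    by (subst sum.swap) (simp add: mult_ac)
qed

text \<open>Schur test with positive weights: each term is split into two factors \<open>b\<close>
  and \<open>c\<close>, and the Cauchy-Schwarz inequality over \<open>F \<times> G\<close> yields
  the geometric mean of the column and row constants.\<close>

lemma schur_test:
  fixes K :: "'i \<Rightarrow> 'j \<Rightarrow> complex"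
  assumes v: "\<And>j. 0 < v j" and w: "\<And>i. 0 < w i" and M: "0 \<le> M\<^sub>1" "0 \<le> M\<^sub>2"
    and col: "\<And>F j. finite F \<Longrightarrow> (\<Sum>i\<in>F. cmod (K i j) * w i) \<le> M\<^sub>1 * v j"
    and row: "\<And>G i. finite G \<Longrightarrow> (\<Sum>j\<in>G. cmod (K i j) * v j) \<le> M\<^sub>2 * w i"
  shows "bounded_kernel K (sqrt (M\<^sub>1 * M\<^sub>2))"
  unfolding bounded_kernel_def
proof (intro conjI allI impI)
  show "0 \<le> sqrt (M\<^sub>1 * M\<^sub>2)" using M by simp
  fix F :: "'i set" and G :: "'j set" and x y assume fin: "finite F" "finite G"
  \<comment> \<open>The weights cancel in the product of \<open>b\<close> and \<open>c\<close>. The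
    squares of \<open>b\<close> summed over \<open>i\<close> meet the column hypothesis, and those
    of \<open>c\<close> summed over \<open>j\<close> meet the row hypothesis.\<close>
  define b where "b = (\<lambda>(i, j). sqrt (cmod (K i j) * w i / v j) * \<bar>x j\<bar>)"
  define c where "c = (\<lambda>(i, j). sqrt (cmod (K i j) * v j / w i) * \<bar>y i\<bar>)"
  let ?S = "\<Sum>i\<in>F. \<Sum>j\<in>G. cmod (K i j) * \<bar>x j\<bar> * \<bar>y i\<bar>"
  have bc: "b (i, j) * c (i, j) = cmod (K i j) * \<bar>x j\<bar> * \<bar>y i\<bar>" for i j
  proof -
    have "sqrt (cmod (K i j) * w i / v j) * sqrt (cmod (K i j) * v j / w i) = cmod (K i j)"
      using v[of j] w[of i] by (simp add: real_sqrt_mult[symmetric] field_simps)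
    then show ?thesis unfolding b_def c_def by (simp add: algebra_simps)
  qed
  have "?S\<^sup>2 = (\<Sum>p\<in>F \<times> G. b p * c p)\<^sup>2"
    by (simp add: sum.cartesian_product bc split_def)
      (simp add: bc[symmetric])
  also have "\<dots> \<le> (\<Sum>p\<in>F \<times> G. (b p)\<^sup>2) * (\<Sum>p\<in>F \<times> G. (c p)\<^sup>2)"
    by (rule Cauchy_Schwarz_ineq_sum)
  also have "\<dots> \<le> (M\<^sub>1 * (L2_set x G)\<^sup>2) * (M\<^sub>2 * (L2_set y F)\<^sup>2)"
  proof (rule mult_mono)
    have "(\<Sum>p\<in>F \<times> G. (b p)\<^sup>2) = (\<Sum>j\<in>G. \<Sum>i\<in>F. (b (i, j))\<^sup>2)"
      by (subst sum.swap) (simp add: sum.cartesian_product)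
    also have "\<dots> = (\<Sum>j\<in>G. (\<Sum>i\<in>F. cmod (K i j) * w i) * ((x j)\<^sup>2 / v j))"
      unfolding sum_distrib_right b_def
      using v w by (intro sum.cong refl) (simp add: power_mult_distrib less_imp_le)
    also have "\<dots> \<le> (\<Sum>j\<in>G. (M\<^sub>1 * v j) * ((x j)\<^sup>2 / v j))"
      using v by (intro sum_mono mult_right_mono col fin) (simp add: less_imp_le)
    also have "\<dots> = M\<^sub>1 * (\<Sum>j\<in>G. (x j)\<^sup>2)"
      unfolding sum_distrib_left using v by (intro sum.cong) (simp_all add: less_imp_neq[symmetric])
    finally show "(\<Sum>p\<in>F \<times> G. (b p)\<^sup>2) \<le> M\<^sub>1 * (L2_set x G)\<^sup>2"
      by (simp add: L2_set_def sum_nonneg)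
    have "(\<Sum>p\<in>F \<times> G. (c p)\<^sup>2) = (\<Sum>i\<in>F. \<Sum>j\<in>G. (c (i, j))\<^sup>2)"
      by (simp add: sum.cartesian_product)
    also have "\<dots> = (\<Sum>i\<in>F. (\<Sum>j\<in>G. cmod (K i j) * v j) * ((y i)\<^sup>2 / w i))"
      unfolding sum_distrib_right c_def
      using v w by (intro sum.cong refl) (simp add: power_mult_distrib less_imp_le)
    also have "\<dots> \<le> (\<Sum>i\<in>F. (M\<^sub>2 * w i) * ((y i)\<^sup>2 / w i))"
      using w by (intro sum_mono mult_right_mono row fin) (simp add: less_imp_le)
    also have "\<dots> = M\<^sub>2 * (\<Sum>i\<in>F. (y i)\<^sup>2)"
      unfolding sum_distrib_left using w by (intro sum.cong) (simp_all add: less_imp_neq[symmetric])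
    finally show "(\<Sum>p\<in>F \<times> G. (c p)\<^sup>2) \<le> M\<^sub>2 * (L2_set y F)\<^sup>2"
      by (simp add: L2_set_def sum_nonneg)
  qed (use M in \<open>auto intro!: sum_nonneg mult_nonneg_nonneg\<close>)
  also have "\<dots> = (sqrt (M\<^sub>1 * M\<^sub>2) * L2_set x G * L2_set y F)\<^sup>2"
    using M by (simp add: power_mult_distrib mult_ac)
  finally show "?S \<le> sqrt (M\<^sub>1 * M\<^sub>2) * L2_set x G * L2_set y F"
    by (rule power2_le_imp_le) (use M in \<open>simp add: L2_set_nonneg\<close>)
qed

lemma schur_test_symmetric:
  assumes "0 \<le> M" and "\<And>i j. cmod (K i j) = cmod (K j i)"
    and "\<And>G i. finite G \<Longrightarrow> (\<Sum>j\<in>G. cmod (K i j)) \<le> M"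
  shows "bounded_kernel K M"
proof -
  have "(\<Sum>i\<in>F. cmod (K i j)) \<le> M" if "finite F" for F j
    using assms(3)[OF that, of j] by (simp add: assms(2)[of _ j])
  then have "bounded_kernel K (sqrt (M * M))"
    using assms(1,3) by (intro schur_test[of "\<lambda>_. 1" "\<lambda>_. 1"]) auto
  then show ?thesis using assms(1) by simp
qed

text \<open>A finite set of pairs lies in the product of its two projections, where the bound on
  finite sections applies.\<close>

lemma bounded_kernel_summable:
  assumes K: "bounded_kernel K M"
    and f: "(\<lambda>j. (cmod (f j))\<^sup>2) summable_on UNIV"
    and g: "(\<lambda>i. (cmod (g i))\<^sup>2) summable_on UNIV"
  shows "(\<lambda>(i, j). K i j * f j * cnj (g i)) summable_on UNIV \<times> UNIV"
proof (rule abs_summable_summable, rule nonneg_bdd_above_summable_on)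
  let ?n = "\<lambda>x :: _ \<Rightarrow> complex. sqrt (\<Sum>\<^sub>\<infinity>i. (cmod (x i))\<^sup>2)"
  have "sum (\<lambda>p. norm (case p of (i, j) \<Rightarrow> K i j * f j * cnj (g i))) P \<le> M * ?n f * ?n g"
    if P: "finite P" for P
  proof -
    have "sum (\<lambda>p. norm (case p of (i, j) \<Rightarrow> K i j * f j * cnj (g i))) P \<le>
      sum (\<lambda>p. norm (case p of (i, j) \<Rightarrow> K i j * f j * cnj (g i))) (fst ` P \<times> snd ` P)"
      using P by (intro sum_mono2) (auto simp: rev_image_eqI)
    also have "\<dots> = (\<Sum>i\<in>fst ` P. \<Sum>j\<in>snd ` P. cmod (K i j) * \<bar>cmod (f j)\<bar> * \<bar>cmod (g i)\<bar>)"
      by (simp add: sum.cartesian_product split_def norm_mult)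
    also have "\<dots> \<le> M * L2_set (\<lambda>j. cmod (f j)) (snd ` P) * L2_set (\<lambda>i. cmod (g i)) (fst ` P)"
      using P by (intro bounded_kernelD[OF K]) auto
    also have "\<dots> \<le> M * ?n f * ?n g"
      using P bounded_kernel_nonneg[OF K] f g
      by (intro mult_mono L2_set_le_infsum) (auto intro!: mult_nonneg_nonneg infsum_nonneg L2_set_nonneg)
    finally show ?thesis .
  qed
  then show "bdd_above (sum (\<lambda>p. norm (case p of (i, j) \<Rightarrow> K i j * f j * cnj (g i))) `
      {F. F \<subseteq> UNIV \<times> UNIV \<and> finite F})"
    by (intro bdd_aboveI[of _ "M * ?n f * ?n g"]) auto
qed auto

lemma bounded_kernel_row_summable:
  assumes K: "bounded_kernel K M"
  shows "(\<lambda>j. cmod (K i j * coord x j)) summable_on UNIV"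
proof (rule nonneg_bdd_above_summable_on)
  have "(\<Sum>j\<in>G. cmod (K i j * coord x j)) \<le> M * norm x" if G: "finite G" for G
  proof -
    have "(\<Sum>j\<in>G. cmod (K i j * coord x j)) \<le> M * L2_set (\<lambda>j. cmod (coord x j)) G"
      using bounded_kernelD[OF K, of "{i}" G "\<lambda>j. cmod (coord x j)" "\<lambda>_. 1"] G
      by (simp add: norm_mult L2_set_def)
    also have "\<dots> \<le> M * norm x"
      by (intro mult_left_mono L2_set_coord_le bounded_kernel_nonneg[OF K] G)
    finally show ?thesis .
  qed
  then show "bdd_above (sum (\<lambda>j. cmod (K i j * coord x j)) ` {F. F \<subseteq> UNIV \<and> finite F})"
    by (intro bdd_aboveI[of _ "M * norm x"]) auto
qed auto

text \<open>Testing the form against the row itself gives \<open>r\<^sup>2 \<le> M * r\<close> for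
  the norm \<open>r\<close> of a finite section. This lets a row act as a vector of the space when
  the operator is composed with its adjoint.\<close>

lemma bounded_kernel_row_square_summable:
  assumes K: "bounded_kernel K M"
  shows "(\<lambda>j. (cmod (K i j))\<^sup>2) summable_on UNIV"
proof (rule square_summable_if_L2_set_le)
  fix G :: "'b set" assume G: "finite G"
  let ?r = "\<lambda>j. cmod (K i j)"
  have "(L2_set ?r G)\<^sup>2 \<le> M * L2_set ?r G"
    using bounded_kernelD[OF K, of "{i}" G ?r "\<lambda>_. 1"] G
    by (simp add: L2_set_def sum_nonneg power2_eq_square)
  then show "L2_set ?r G \<le> M"
    using bounded_kernel_nonneg[OF K] L2_set_nonneg[of ?r G]
    by (cases "L2_set ?r G = 0") (auto simp: power2_eq_square)
qed

section \<open>Bounded operators defined by kernels\<close>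

definition kernel_op :: "('i \<Rightarrow> 'j \<Rightarrow> complex) \<Rightarrow> ('j ell2 \<Rightarrow>\<^sub>L 'i ell2)" where
  "kernel_op K = Blinfun (\<lambda>x. Abs_ell2 (\<lambda>i. \<Sum>\<^sub>\<infinity>j. K i j * coord x j))"

lemma has_sum_sum:
  fixes f :: "'a \<Rightarrow> 'b \<Rightarrow> 'c::topological_comm_monoid_add"
  assumes "finite F" "\<And>i. i \<in> F \<Longrightarrow> (f i has_sum S i) A"
  shows "((\<lambda>j. \<Sum>i\<in>F. f i j) has_sum (\<Sum>i\<in>F. S i)) A"
  using assms by (induction F) (simp_all add: has_sum_add)

text \<open>The vector \<open>r\<close> of absolute row sums dominates the image and is also taken
  as the test vector. On \<open>F\<close> this bounds the square of its norm by
  \<open>M * norm x\<close> times its norm, and one factor is divided out.\<close>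

lemma bounded_kernel_image:
  fixes x :: "'j ell2"
  assumes K: "bounded_kernel K M" and F: "finite F"
  shows "L2_set (\<lambda>i. cmod (\<Sum>\<^sub>\<infinity>j. K i j * coord x j)) F \<le> M * norm x"
proof -
  define r where "r = (\<lambda>i. \<Sum>\<^sub>\<infinity>j. cmod (K i j * coord x j))"
  note row = bounded_kernel_row_summable[OF K]
  have r0: "0 \<le> r i" for i unfolding r_def by (intro infsum_nonneg) simp
  have "(L2_set r F)\<^sup>2 = (\<Sum>i\<in>F. r i * r i)"
    by (simp add: L2_set_def sum_nonneg power2_eq_square)
  \<comment> \<open>One factor \<open>r i\<close> is expanded as an infinite sum over
    \<open>j\<close>; the bound is then needed for finite \<open>G\<close> only and passes to the
    limit.\<close>
  also have "\<dots> \<le> M * norm x * L2_set r F"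
  proof (rule has_sum_le_finite_sums)
    show "((\<lambda>j. \<Sum>i\<in>F. cmod (K i j * coord x j) * r i) has_sum (\<Sum>i\<in>F. r i * r i)) UNIV"
      unfolding r_def by (intro has_sum_sum F has_sum_cmult_left has_sum_infsum row)
    fix G :: "'j set" assume G: "finite G"
    have "(\<Sum>j\<in>G. \<Sum>i\<in>F. cmod (K i j * coord x j) * r i) =
      (\<Sum>i\<in>F. \<Sum>j\<in>G. cmod (K i j) * \<bar>cmod (coord x j)\<bar> * \<bar>r i\<bar>)"
      using r0 by (subst sum.swap) (simp add: norm_mult)
    also have "\<dots> \<le> M * L2_set (\<lambda>j. cmod (coord x j)) G * L2_set r F"
      by (rule bounded_kernelD[OF K F G])
    also have "\<dots> \<le> M * norm x * L2_set r F"
      using bounded_kernel_nonneg[OF K] G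
      by (intro mult_right_mono mult_left_mono L2_set_coord_le L2_set_nonneg) auto
    finally show "(\<Sum>j\<in>G. \<Sum>i\<in>F. cmod (K i j * coord x j) * r i) \<le> M * norm x * L2_set r F" .
  qed
  finally have "L2_set r F \<le> M * norm x"
    using bounded_kernel_nonneg[OF K] L2_set_nonneg[of r F]
    by (cases "L2_set r F = 0") (auto simp: power2_eq_square)
  moreover have "L2_set (\<lambda>i. cmod (\<Sum>\<^sub>\<infinity>j. K i j * coord x j)) F \<le> L2_set r F"
    unfolding r_def by (intro L2_set_mono norm_infsum_bound) (simp_all add: row)
  ultimately show ?thesis by simp
qed

lemma
  assumes K: "bounded_kernel K M"
  shows coord_kernel_op: "coord (kernel_op K x) i = (\<Sum>\<^sub>\<infinity>j. K i j * coord x j)" (is ?c)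
    and norm_kernel_op_le: "norm (kernel_op K) \<le> M" (is ?n)
proof -
  let ?f = "\<lambda>x. Abs_ell2 (\<lambda>i. \<Sum>\<^sub>\<infinity>j. K i j * coord x j)"
  note mem = square_summable_if_L2_set_le(1)[OF bounded_kernel_image[OF K]]
  have co: "coord (?f x) i = (\<Sum>\<^sub>\<infinity>j. K i j * coord x j)" for x i
    using mem by (subst Abs_ell2_inverse) auto
  have row: "(\<lambda>j. K i j * coord x j) summable_on UNIV" for i x
    by (rule abs_summable_summable[OF bounded_kernel_row_summable[OF K]])
  have nrm: "norm (?f x) \<le> M * norm x" for x
    unfolding ell2_norm[of "?f x"] co
    by (rule square_summable_if_L2_set_le(2)[OF bounded_kernel_image[OF K]])
  have bl: "bounded_linear ?f"
  proof (rule bounded_linear_intro[where K = M])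
    show "?f (x + y) = ?f x + ?f y" for x y
    proof (rule ell2_eqI)
      show "coord (?f (x + y)) i = coord (?f x + ?f y) i" for i
        using co[of "x + y" i]
        by (simp only: plus_ell2.rep_eq[of "?f x"] co[of x] co[of y])
          (simp only: plus_ell2.rep_eq distrib_left infsum_add[OF row row])
    qed
    show "?f (r *\<^sub>R x) = r *\<^sub>R ?f x" for r x
    proof (rule ell2_eqI)
      show "coord (?f (r *\<^sub>R x)) i = coord (r *\<^sub>R ?f x) i" for i
        unfolding co[of "r *\<^sub>R x"] scaleR_ell2.rep_eq[of r "?f x"] co[of x]
        by (simp add: scaleR_ell2.rep_eq infsum_scaleR_right[symmetric])
    qed
    show "norm (?f x) \<le> norm x * M" for x using nrm[of x] by (simp add: mult.commute)
  qed
  have ap: "blinfun_apply (kernel_op K) = ?f"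
    unfolding kernel_op_def by (rule bounded_linear_Blinfun_apply[OF bl])
  show ?c unfolding ap co ..
  show ?n
    using nrm bounded_kernel_nonneg[OF K] by (intro norm_blinfun_bound) (simp_all add: ap)
qed

lemma coord_kernel_op_has_sum:
  assumes "bounded_kernel K M"
  shows "((\<lambda>j. K i j * coord x j) has_sum coord (kernel_op K x) i) UNIV"
  unfolding coord_kernel_op[OF assms]
  by (rule has_sum_infsum[OF abs_summable_summable[OF bounded_kernel_row_summable[OF assms]]])

section \<open>Adjoints and the norm of an operator times its adjoint\<close>

lemma cinner_kernel_op:
  assumes K: "bounded_kernel K M"
  shows "cinner (kernel_op K x) y = cinner x (kernel_op (\<lambda>j i. cnj (K i j)) y)"
proof -
  note K' = bounded_kernel_adjoint[OF K]
  have "cinner (kernel_op K x) y = (\<Sum>\<^sub>\<infinity>i. \<Sum>\<^sub>\<infinity>j. K i j * coord x j * cnj (coord y i))"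
    unfolding cinner_def coord_kernel_op[OF K] infsum_cmult_left' ..
  also have "\<dots> = (\<Sum>\<^sub>\<infinity>j. \<Sum>\<^sub>\<infinity>i. K i j * coord x j * cnj (coord y i))"
    by (rule infsum_swap_banach[OF bounded_kernel_summable[OF K]]) (rule coord_cmod_summable)+
  also have "\<dots> = (\<Sum>\<^sub>\<infinity>j. coord x j * (\<Sum>\<^sub>\<infinity>i. K i j * cnj (coord y i)))"
    by (simp add: infsum_cmult_right'[symmetric] mult_ac)
  also have "\<dots> = cinner x (kernel_op (\<lambda>j i. cnj (K i j)) y)"
    unfolding cinner_def coord_kernel_op[OF K'] infsum_cnj[symmetric] by simp
  finally show ?thesis .
qed

text \<open>Pairing with unit vectors reads off the coordinates. This is the uniqueness behind the
  definite description of the adjoint.\<close>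

lemma cinner_ext:
  fixes y z :: "'i ell2"
  assumes "\<And>x. cinner x y = cinner x z"
  shows "y = z"
proof (rule ell2_eqI)
  fix k :: 'i
  let ?e = "Abs_ell2 (\<lambda>i. if i = k then 1 else 0)"
  have "coord ?e = (\<lambda>i. if i = k then 1 else 0)"
    by (rule Abs_ell2_inverse)
      (auto intro!: finite_nonzero_values_imp_summable_on finite_subset[of _ "{k}"] split: if_splits)
  moreover have "(\<Sum>\<^sub>\<infinity>i. (if i = k then 1 else 0) * cnj (coord w i)) = cnj (coord w k)" for w
    by (rule trans[OF infsum_cong_neutral[where T = "{k}"]]) auto
  ultimately have "cinner ?e w = cnj (coord w k)" for w
    unfolding cinner_def by metis
  then show "coord y k = coord z k" using assms[of ?e] by simp
qed

lemma hilbert_adjoint_eqI: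
  assumes "\<And>x y. cinner (blinfun_apply T x) y = cinner x (blinfun_apply S y)"
  shows "hilbert_adjoint T = S"
  unfolding hilbert_adjoint_def
proof (rule the_equality)
  fix S' assume "\<forall>x y. cinner (blinfun_apply T x) y = cinner x (blinfun_apply S' y)"
  then have "S' y = S y" for y using assms by (intro cinner_ext) metis
  then show "S' = S" by (rule blinfun_eqI)
qed (simp add: assms)

lemma hilbert_adjoint_kernel_op:
  "bounded_kernel K M \<Longrightarrow> hilbert_adjoint (kernel_op K) = kernel_op (\<lambda>j i. cnj (K i j))"
  by (intro hilbert_adjoint_eqI cinner_kernel_op)

text \<open>The square of the norm of \<open>T x\<close> is the inner product of \<open>x\<close>
  with \<open>S (T x)\<close>, to which the Cauchy-Schwarz inequality applies.\<close>

lemma norm_le_norm_adjoint_compose: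
  fixes T :: "'i ell2 \<Rightarrow>\<^sub>L 'j ell2"
  assumes "\<And>x y. cinner (blinfun_apply T x) y = cinner x (blinfun_apply S y)"
  shows "(norm T)\<^sup>2 \<le> norm (S o\<^sub>L T)"
proof -
  have "norm (T x) \<le> sqrt (norm (S o\<^sub>L T)) * norm x" for x
  proof (rule power2_le_imp_le)
    have "(norm (T x))\<^sup>2 = inner x ((S o\<^sub>L T) x)"
      by (simp add: power2_norm_eq_inner inner_ell2_def assms)
    also have "\<dots> \<le> norm x * norm ((S o\<^sub>L T) x)" by (rule norm_cauchy_schwarz)
    also have "\<dots> \<le> norm x * (norm (S o\<^sub>L T) * norm x)"
      by (intro mult_left_mono norm_blinfun norm_ge_zero)
    finally show "(norm (T x))\<^sup>2 \<le> (sqrt (norm (S o\<^sub>L T)) * norm x)\<^sup>2"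
      by (simp add: power_mult_distrib power2_eq_square[of "norm x"] mult_ac)
  qed simp
  then have "norm T \<le> sqrt (norm (S o\<^sub>L T))" by (intro norm_blinfun_bound) auto
  then have "(norm T)\<^sup>2 \<le> (sqrt (norm (S o\<^sub>L T)))\<^sup>2" by (intro power_mono) auto
  then show ?thesis by simp
qed

text \<open>The preceding inequality is used for \<open>T\<close> and, with the roles exchanged, for
  \<open>S\<close>. Together with submultiplicativity this forces \<open>norm S = norm T\<close>,
  and then the upper and lower bounds for \<open>norm (T o\<^sub>L S)\<close> coincide.\<close>

lemma norm_compose_adjoint:
  fixes T :: "'i ell2 \<Rightarrow>\<^sub>L 'j ell2"
  assumes adj: "\<And>x y. cinner (blinfun_apply T x) y = cinner x (blinfun_apply S y)"
  shows "norm (T o\<^sub>L S) = (norm T)\<^sup>2"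
proof -
  have cnj: "cinner x y = cnj (cinner y x)" for x y :: "'k ell2"
    unfolding cinner_def infsum_cnj[symmetric] by (simp add: mult.commute)
  have adj': "cinner (S y) x = cinner y (T x)" for x y
    using adj[of x y] cnj by metis
  have TS: "(norm T)\<^sup>2 \<le> norm S * norm T" and ST: "(norm S)\<^sup>2 \<le> norm (T o\<^sub>L S)"
    using norm_le_norm_adjoint_compose[OF adj] norm_le_norm_adjoint_compose[OF adj']
      norm_blinfun_compose[of S T] by auto
  have STT: "norm (T o\<^sub>L S) \<le> norm T * norm S" by (rule norm_blinfun_compose)
  have "norm T \<le> norm S"
    using TS by (cases "norm T = 0") (auto simp: power2_eq_square)
  moreover have "norm S \<le> norm T"
    using ST STT by (cases "norm S = 0") (auto simp: power2_eq_square dest: order_trans)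
  ultimately have "norm S = norm T" by simp
  then show ?thesis using ST STT by (simp add: power2_eq_square)
qed

text \<open>The matrix of the product with the adjoint is the Gram matrix of the rows. Stating this
  with \<open>has_sum\<close> records convergence, so that such series can be subtracted term by
  term.\<close>

lemma kernel_op_compose_adjoint_has_sum:
  assumes K: "bounded_kernel K M"
  shows "((\<lambda>k. (\<Sum>\<^sub>\<infinity>j. K i j * cnj (K k j)) * coord y k) has_sum
      coord ((kernel_op K o\<^sub>L kernel_op (\<lambda>j i. cnj (K i j))) y) i) UNIV"
proof -
  note K' = bounded_kernel_adjoint[OF K]
  have "(\<lambda>(j, k). cnj (K k j) * coord y k * cnj (cnj (K i j))) summable_on UNIV \<times> UNIV"
    using bounded_kernel_row_square_summable[OF K, of i]
    by (intro bounded_kernel_summable[OF K'] coord_cmod_summable) simp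
  then have s: "(\<lambda>(j, k). K i j * (cnj (K k j) * coord y k)) summable_on UNIV \<times> UNIV"
    by (simp add: mult_ac)
  have "coord ((kernel_op K o\<^sub>L kernel_op (\<lambda>j i. cnj (K i j))) y) i =
      (\<Sum>\<^sub>\<infinity>j. \<Sum>\<^sub>\<infinity>k. K i j * (cnj (K k j) * coord y k))"
    by (simp add: coord_kernel_op[OF K] coord_kernel_op[OF K'] infsum_cmult_right')
  also have "\<dots> = (\<Sum>\<^sub>\<infinity>k. \<Sum>\<^sub>\<infinity>j. K i j * (cnj (K k j) * coord y k))"
    by (rule infsum_swap_banach[OF s])
  finally have eq: "coord ((kernel_op K o\<^sub>L kernel_op (\<lambda>j i. cnj (K i j))) y) i =
    (\<Sum>\<^sub>\<infinity>k. (\<Sum>\<^sub>\<infinity>j. K i j * cnj (K k j)) * coord y k)"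
    by (simp add: mult.assoc[symmetric] infsum_cmult_left')
  have "(\<lambda>(k, j). K i j * (cnj (K k j) * coord y k)) summable_on UNIV \<times> UNIV"
    using s summable_on_swap[of "\<lambda>(j, k). K i j * (cnj (K k j) * coord y k)" UNIV UNIV]
    by (simp add: split_def)
  from summable_on_Sigma_banach[OF this]
  have "(\<lambda>k. (\<Sum>\<^sub>\<infinity>j. K i j * cnj (K k j)) * coord y k) summable_on UNIV"
    by (simp add: mult.assoc[symmetric] infsum_cmult_left')
  then show ?thesis unfolding eq by (rule has_sum_infsum)
qed

section \<open>Comparing sums of powers of the logarithm with integrals\<close>

text \<open>Repeated integration by parts of \<open>x\<^sup>-\<^sup>1\<^sup>-\<^sup>s (ln x)\<^sup>m\<close>, normalised to vanish at infinity.\<close>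

fun ln_power_primitive :: "nat \<Rightarrow> real \<Rightarrow> real \<Rightarrow> real" where
  "ln_power_primitive 0 s x = - (x powr (- s) / s)"
| "ln_power_primitive (Suc m) s x =
     - (x powr (- s) * ln x ^ Suc m / s) + real (Suc m) / s * ln_power_primitive m s x"

lemma ln_power_primitive_deriv:
  assumes "s > 0" "x > 0"
  shows "(ln_power_primitive m s has_real_derivative x powr (- 1 - s) * ln x ^ m) (at x)"
proof (induction m)
  case 0
  have "((\<lambda>x. - (x powr (- s) / s)) has_real_derivative x powr (- 1 - s)) (at x)"
    using assms by (auto intro!: derivative_eq_intros simp: field_simps powr_diff powr_minus)
  then show ?case by simp
next
  case (Suc m)
  have "((\<lambda>x. - (x powr (- s) * ln x ^ Suc m / s) + real (Suc m) / s * ln_power_primitive m s x)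
      has_real_derivative x powr (- 1 - s) * ln x ^ Suc m) (at x)"
    using assms
    by (auto intro!: derivative_eq_intros Suc simp del: power_Suc
        simp: field_simps powr_diff powr_minus)
  then show ?case by simp
qed

text \<open>At 1 the logarithmic terms vanish, and the recursion builds up the factorial. Up to sign
  this is the integral of \<open>x powr (- 1 - s) * ln x ^ m\<close> over the half-line from
  1.\<close>

lemma ln_power_primitive_1: "s > 0 \<Longrightarrow> ln_power_primitive m s 1 = - (fact m / s ^ (m + 1))"
proof (induction m)
  case (Suc m)
  then have "ln_power_primitive m s 1 = - (fact m / s ^ (m + 1))" by simp
  then show ?case using Suc.prems by (simp del: of_nat_Suc)
qed simp

text \<open>Substituting \<open>u = s * ln x\<close> reduces the claim to the decay of
  \<open>u ^ m / exp u\<close>.\<close>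

lemma powr_neg_mult_ln_power_tendsto_0:
  assumes "s > 0"
  shows "((\<lambda>x::real. x powr (- s) * ln x ^ m) \<longlongrightarrow> 0) at_top"
proof -
  have "filterlim (\<lambda>x::real. s * ln x) at_top at_top"
    using assms by (intro filterlim_tendsto_pos_mult_at_top[OF tendsto_const] ln_at_top)
  from filterlim_compose[OF tendsto_power_div_exp_0 this]
  have "((\<lambda>x. (s * ln x) ^ m / exp (s * ln x)) \<longlongrightarrow> 0) at_top" .
  from tendsto_mult_left[OF this, of "1 / s ^ m"]
  have "((\<lambda>x. 1 / s ^ m * ((s * ln x) ^ m / exp (s * ln x))) \<longlongrightarrow> 0) at_top" by simp
  then show ?thesis
  proof (rule Lim_transform_eventually)
    show "\<forall>\<^sub>F x::real in at_top. 1 / s ^ m * ((s * ln x) ^ m / exp (s * ln x)) = x powr (- s) * ln x ^ m"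
      using eventually_gt_at_top[of 0]
      by eventually_elim (use assms in \<open>simp add: power_mult_distrib powr_def exp_minus field_simps\<close>)
  qed
qed

lemma ln_power_primitive_tendsto_0:
  assumes "s > 0"
  shows "(ln_power_primitive m s \<longlongrightarrow> 0) at_top"
proof (induction m)
  case 0
  have "((\<lambda>x. - (x powr (- s) * ln x ^ 0 / s)) \<longlongrightarrow> - (0 / s)) at_top"
    using assms by (intro tendsto_intros powr_neg_mult_ln_power_tendsto_0) auto
  then show ?case by simp
next
  case (Suc m)
  have "((\<lambda>x. - (x powr (- s) * ln x ^ Suc m / s) + real (Suc m) / s * ln_power_primitive m s x)
      \<longlongrightarrow> - (0 / s) + real (Suc m) / s * 0) at_top"
    using assms by (intro tendsto_intros powr_neg_mult_ln_power_tendsto_0 Suc) auto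
  then show ?case by simp
qed

text \<open>On each interval \<open>[n, n + 1]\<close> the mean value theorem replaces the integral by a value of
  the integrand, and the oscillation is controlled by a primitive \<open>V\<close> of a majorant of the
  modulus of the derivative; the errors then telescope.\<close>

lemma sum_ln_power:
  fixes s :: real and m :: nat
  assumes s: "s > 0"
  defines "f \<equiv> \<lambda>n. real (Suc n) powr (- 1 - s) * ln (real (Suc n)) ^ m"
  shows "summable f" and "\<bar>suminf f - fact m / s ^ (m + 1)\<bar> \<le> 2 * fact m / (1 + s) ^ m"
proof -
  define G where "G = ln_power_primitive m s"
  define h where "h = (\<lambda>x::real. x powr (- 1 - s) * ln x ^ m)"
  \<comment> \<open>The two terms of \<open>h'\<close> have opposite signs for
    \<open>x \<ge> 1\<close>; \<open>v\<close> takes both with a positive sign, so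
    \<open>\<bar>h'\<bar> \<le> v\<close> there, and \<open>V\<close> is the primitive of
    \<open>v\<close> vanishing at infinity. For \<open>m = 0\<close> the truncated
    \<open>m - 1\<close> is harmless because of the factor \<open>real m\<close>.\<close>
  define V where "V = (\<lambda>x. (1 + s) * ln_power_primitive m (1 + s) x
      + real m * ln_power_primitive (m - 1) (1 + s) x)"
  define v where "v = (\<lambda>x::real. (1 + s) * (x powr (- 1 - (1 + s)) * ln x ^ m)
      + real m * (x powr (- 1 - (1 + s)) * ln x ^ (m - 1)))"
  define h' where "h' = (\<lambda>x::real. - (1 + s) * (x powr (- 1 - (1 + s)) * ln x ^ m)
      + real m * (x powr (- 1 - (1 + s)) * ln x ^ (m - 1)))"
  have dG: "(G has_real_derivative h x) (at x)" if "x > 0" for x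
    unfolding G_def h_def using that s by (intro ln_power_primitive_deriv)
  have dV: "(V has_real_derivative v x) (at x)" if "x > 0" for x
    unfolding V_def v_def using that s
    by (intro DERIV_add DERIV_cmult ln_power_primitive_deriv) auto
  have dh: "(h has_real_derivative h' x) (at x)" if "x > 0" for x
    unfolding h_def h'_def
    by (rule DERIV_cong[OF DERIV_mult[OF has_real_derivative_powr[OF that] DERIV_power[OF DERIV_ln[OF that]]]])
      (use that in \<open>simp add: field_simps powr_diff powr_minus power2_eq_square\<close>)
  \<comment> \<open>Both \<open>V - h\<close> and \<open>V + h\<close> are nondecreasing, which
    bounds the increment of \<open>h\<close> from either side.\<close>
  have osc: "\<bar>h y - h x\<bar> \<le> V y - V x" if "1 \<le> x" "x \<le> y" for x y
  proof -
    have "V x - h x \<le> V y - h y"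
    proof (rule DERIV_nonneg_imp_nondecreasing[OF that(2)])
      fix t assume "x \<le> t" "t \<le> y"
      then have t: "t \<ge> 1" using that by simp
      have "((\<lambda>x. V x - h x) has_real_derivative v t - h' t) (at t)"
        using t by (intro DERIV_diff dV dh) auto
      moreover have "v t - h' t = 2 * (1 + s) * (t powr (- 1 - (1 + s)) * ln t ^ m)"
        unfolding v_def h'_def by (simp add: algebra_simps)
      then have "0 \<le> v t - h' t" using t s by simp
      ultimately show "\<exists>d. ((\<lambda>x. V x - h x) has_real_derivative d) (at t) \<and> 0 \<le> d" by blast
    qed
    moreover have "V x + h x \<le> V y + h y"
    proof (rule DERIV_nonneg_imp_nondecreasing[OF that(2)])
      fix t assume "x \<le> t" "t \<le> y"
      then have t: "t \<ge> 1" using that by simp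
      have "((\<lambda>x. V x + h x) has_real_derivative v t + h' t) (at t)"
        using t by (intro DERIV_add dV dh) auto
      moreover have "v t + h' t = 2 * real m * (t powr (- 1 - (1 + s)) * ln t ^ (m - 1))"
        unfolding v_def h'_def by (simp add: algebra_simps)
      then have "0 \<le> v t + h' t" using t by simp
      ultimately show "\<exists>d. ((\<lambda>x. V x + h x) has_real_derivative d) (at t) \<and> 0 \<le> d" by blast
    qed
    ultimately show ?thesis by linarith
  qed
  define dG where "dG = (\<lambda>n. G (real (Suc (Suc n))) - G (real (Suc n)))"
  define dV where "dV = (\<lambda>n. V (real (Suc (Suc n))) - V (real (Suc n)))"
  have err: "norm (f n - dG n) \<le> dV n" for n
  proof -
    let ?a = "real (Suc n)"
    have "\<exists>z>?a. z < ?a + 1 \<and> G (?a + 1) - G ?a = (?a + 1 - ?a) * h z"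
      using dG by (intro MVT2) auto
    then obtain z where z: "?a < z" "z < ?a + 1" "G (?a + 1) - G ?a = h z" by auto
    have "\<bar>h z - h ?a\<bar> \<le> V z - V ?a" using z by (intro osc) auto
    moreover have "V z \<le> V (?a + 1)" using osc[of z "?a + 1"] z by auto
    ultimately show ?thesis
      using z unfolding f_def dG_def dV_def h_def by (simp add: add_ac)
  qed
  have lim: "(\<lambda>n. F (real (Suc n))) \<longlonglongrightarrow> 0" if "(F \<longlongrightarrow> 0) at_top" for F :: "real \<Rightarrow> real"
    using that filterlim_compose[OF filterlim_real_sequentially filterlim_Suc]
    by (rule filterlim_compose)
  have G_sums: "dG sums (fact m / s ^ (m + 1))"
    using telescope_sums[OF lim[of G]] s
    by (simp add: dG_def G_def ln_power_primitive_tendsto_0 ln_power_primitive_1)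
  \<comment> \<open>The value \<open>- V 1\<close> is the integral of \<open>v\<close> over the
    half-line from 1. Each term contributes \<open>fact m / (1 + s) ^ m\<close>, except that the
    second is absent for \<open>m = 0\<close>.\<close>
  have V1: "- V 1 \<le> (2 * fact m / (1 + s) ^ m)"
  proof (cases m)
    case 0
    then show ?thesis using s unfolding V_def by (simp add: ln_power_primitive_1)
  next
    case (Suc k)
    have "(1 + s) * (fact m / (1 + s) ^ (m + 1)) = fact m / (1 + s) ^ m"
      "real m * (fact (m - 1) / (1 + s) ^ (m - 1 + 1)) = fact m / (1 + s) ^ m"
      using s Suc by simp_all
    then have "V 1 = - (fact m / (1 + s) ^ m) - fact m / (1 + s) ^ m"
      using s unfolding V_def by (simp only: ln_power_primitive_1 mult_minus_right)
    then show ?thesis by simp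
  qed
  have "(V \<longlongrightarrow> (1 + s) * 0 + real m * 0) at_top"
    unfolding V_def using s by (intro tendsto_intros ln_power_primitive_tendsto_0) auto
  then have V_sums: "dV sums - V 1"
    using telescope_sums[OF lim[of V]] by (simp add: dV_def)
  have se: "summable (\<lambda>n. norm (f n - dG n))"
    by (rule summable_comparison_test[OF _ sums_summable[OF V_sums]]) (use err in auto)
  have "summable (\<lambda>n. (f n - dG n) + dG n)"
    by (intro summable_add summable_norm_cancel[OF se] sums_summable[OF G_sums])
  then show sf: "summable f" by simp
  have "suminf f - fact m / s ^ (m + 1) = (\<Sum>n. f n - dG n)"
    using suminf_diff[OF sf sums_summable[OF G_sums]] sums_unique[OF G_sums] by simp
  also have "norm \<dots> \<le> (\<Sum>n. norm (f n - dG n))" by (rule summable_norm[OF se])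
  also have "\<dots> \<le> suminf dV"
    by (intro suminf_le err se sums_summable[OF V_sums])
  also have "\<dots> \<le> 2 * fact m / (1 + s) ^ m" using V_sums V1 by (simp add: sums_iff)
  finally show "\<bar>suminf f - fact m / s ^ (m + 1)\<bar> \<le> 2 * fact m / (1 + s) ^ m" by simp
qed

section \<open>Multinomial sums\<close>

text \<open>This is the term of index \<open>\<alpha>\<close> in the multinomial expansion of the
  power \<open>mi_abs \<alpha>\<close> of the sum of the coordinates of
  \<open>\<rho>\<close>.\<close>

definition mi_coeff :: "real^'d \<Rightarrow> 'd::finite multi_index \<Rightarrow> real" where
  "mi_coeff \<rho> \<alpha> = fact (mi_abs \<alpha>) * mi_power \<rho> \<alpha> / mi_fact \<alpha>"

lemma mi_fact_pos: "mi_fact \<alpha> > 0"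
  unfolding mi_fact_def by (intro prod_pos) simp

lemma B_set_nonneg: "\<rho> \<in> B_set \<Longrightarrow> 0 \<le> \<rho> $ j"
  unfolding B_set_def by blast

lemma mi_coeff_nonneg: "\<rho> \<in> B_set \<Longrightarrow> 0 \<le> mi_coeff \<rho> \<alpha>"
  unfolding mi_coeff_def mi_power_def
  by (intro divide_nonneg_pos mult_nonneg_nonneg prod_nonneg mi_fact_pos) (auto simp: B_set_nonneg)

lemma
  fixes \<rho> :: "real^'d::finite"
  assumes "0 < \<beta> j"
  shows mi_abs_dec: "mi_abs \<beta> = Suc (mi_abs (\<beta>(j := \<beta> j - 1)))" (is ?abs)
    and mi_fact_dec: "mi_fact \<beta> = real (\<beta> j) * mi_fact (\<beta>(j := \<beta> j - 1))" (is ?fact)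
    and mi_power_dec: "mi_power \<rho> \<beta> = \<rho> $ j * mi_power \<rho> (\<beta>(j := \<beta> j - 1))" (is ?power)
proof -
  let ?g = "\<beta>(j := \<beta> j - 1)"
  have abs: "mi_abs \<gamma> = \<gamma> j + (\<Sum>i\<in>UNIV - {j}. \<gamma> i)" for \<gamma> :: "'d multi_index"
    unfolding mi_abs_def by (rule sum.remove) auto
  show ?abs unfolding abs using assms by simp
  have fact: "mi_fact \<gamma> = fact (\<gamma> j) * (\<Prod>i\<in>UNIV - {j}. fact (\<gamma> i))" for \<gamma> :: "'d multi_index"
    unfolding mi_fact_def by (rule prod.remove) auto
  show ?fact unfolding fact using assms by (simp add: fact_reduce[of "\<beta> j"])
  have pow: "mi_power \<rho> \<gamma> = \<rho> $ j ^ \<gamma> j * (\<Prod>i\<in>UNIV - {j}. \<rho> $ i ^ \<gamma> i)" for \<gamma> :: "'d multi_index"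
    unfolding mi_power_def by (rule prod.remove) auto
  show ?power unfolding pow using assms power_minus_mult[of "\<beta> j" "\<rho> $ j"] by (simp add: mult_ac)
qed

text \<open>Pascal recursion for multinomial terms: index \<open>j\<close> contributes the fraction
  \<open>\<beta> j / mi_abs \<beta>\<close> of the term, and these fractions add up to 1.\<close>

lemma mi_coeff_Suc:
  assumes "mi_abs \<beta> = Suc k"
  shows "mi_coeff \<rho> \<beta> = (\<Sum>j | 0 < \<beta> j. \<rho> $ j * mi_coeff \<rho> (\<beta>(j := \<beta> j - 1)))"
proof -
  have step: "\<rho> $ j * mi_coeff \<rho> (\<beta>(j := \<beta> j - 1)) = real (\<beta> j) * (fact k * mi_power \<rho> \<beta> / mi_fact \<beta>)"
    if "0 < \<beta> j" for j
  proof -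
    have "mi_abs (\<beta>(j := \<beta> j - 1)) = k" using mi_abs_dec[of \<beta> j, OF that] assms by simp
    then show ?thesis
      unfolding mi_coeff_def mi_fact_dec[of \<beta> j, OF that] mi_power_dec[of \<beta> j \<rho>, OF that]
      using that by simp
  qed
  have "(\<Sum>j | 0 < \<beta> j. \<rho> $ j * mi_coeff \<rho> (\<beta>(j := \<beta> j - 1))) =
      (\<Sum>j | 0 < \<beta> j. real (\<beta> j)) * (fact k * mi_power \<rho> \<beta> / mi_fact \<beta>)"
    unfolding sum_distrib_right by (intro sum.cong refl step) simp
  also have "(\<Sum>j | 0 < \<beta> j. real (\<beta> j)) = (\<Sum>j\<in>UNIV. real (\<beta> j))"
    by (rule sum.mono_neutral_left) auto
  also have "\<dots> = real (Suc k)" using assms by (simp add: mi_abs_def flip: of_nat_sum)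
  finally show ?thesis unfolding mi_coeff_def assms by simp
qed

text \<open>Multinomial theorem as an inequality: the terms of degree \<open>k\<close> add up to at
  most a power of the coordinate sum, which is at most 1 on \<open>B_set\<close>. The induction uses
  the Pascal recursion.\<close>

lemma sum_mi_coeff_le_1:
  fixes \<rho> :: "real^'d"
  assumes \<rho>: "\<rho> \<in> B_set" and "finite F" "\<And>\<beta>. \<beta> \<in> F \<Longrightarrow> mi_abs \<beta> = k"
  shows "(\<Sum>\<beta>\<in>F. mi_coeff \<rho> \<beta>) \<le> 1"
  using assms(2,3)
proof (induction k arbitrary: F)
  case 0
  have "F \<subseteq> {\<lambda>_. 0}" using 0 by (auto simp: mi_abs_def)
  then consider "F = {}" | "F = {\<lambda>_. 0}" by blast
  then show ?case by cases (simp_all add: mi_coeff_def mi_abs_def mi_power_def mi_fact_def)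
next
  case (Suc k)
  have "(\<Sum>\<beta>\<in>F. mi_coeff \<rho> \<beta>) = (\<Sum>\<beta>\<in>F. \<Sum>j | 0 < \<beta> j. \<rho> $ j * mi_coeff \<rho> (\<beta>(j := \<beta> j - 1)))"
    using Suc.prems by (intro sum.cong refl mi_coeff_Suc)
  also have "\<dots> = (\<Sum>j\<in>UNIV. \<Sum>\<beta> | \<beta> \<in> F \<and> 0 < \<beta> j. \<rho> $ j * mi_coeff \<rho> (\<beta>(j := \<beta> j - 1)))"
    using sum.swap_restrict[of F UNIV "\<lambda>\<beta> j. \<rho> $ j * mi_coeff \<rho> (\<beta>(j := \<beta> j - 1))"
        "\<lambda>\<beta> j. 0 < \<beta> j"] Suc.prems by simp
  also have "\<dots> \<le> (\<Sum>j\<in>UNIV. \<rho> $ j * 1)"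
  proof (rule sum_mono)
    fix j
    let ?F = "{\<beta> \<in> F. 0 < \<beta> j}" and ?r = "\<lambda>\<beta> :: 'd \<Rightarrow> nat. \<beta>(j := \<beta> j - 1)"
    \<comment> \<open>Lowering coordinate \<open>j\<close> is injective where it is positive, so the
      inner sum runs over distinct indices of degree \<open>k\<close> and the induction hypothesis
      applies.\<close>
    have inj: "inj_on ?r ?F"
    proof (rule inj_onI)
      fix \<beta> \<gamma> assume *: "\<beta> \<in> ?F" "\<gamma> \<in> ?F" "?r \<beta> = ?r \<gamma>"
      have "\<beta> i = \<gamma> i" for i
        using fun_cong[OF *(3), of i] *(1,2) by (cases "i = j") auto
      then show "\<beta> = \<gamma>" by blast
    qed
    have "(\<Sum>\<beta>\<in>?F. mi_coeff \<rho> (?r \<beta>)) = (\<Sum>\<gamma>\<in>?r ` ?F. mi_coeff \<rho> \<gamma>)"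
      by (simp only: sum.reindex[OF inj] o_def)
    also have "\<dots> \<le> 1"
    proof (rule Suc.IH)
      show "mi_abs \<gamma> = k" if "\<gamma> \<in> ?r ` ?F" for \<gamma>
      proof -
        from that obtain \<beta> where \<beta>: "\<beta> \<in> F" "0 < \<beta> j" "\<gamma> = ?r \<beta>" by blast
        from mi_abs_dec[of \<beta> j, OF \<beta>(2)] Suc.prems(2)[OF \<beta>(1)] show ?thesis
          unfolding \<beta>(3) by simp
      qed
      show "finite (?r ` ?F)" using Suc.prems(1) by simp
    qed
    finally have "\<rho> $ j * (\<Sum>\<beta>\<in>?F. mi_coeff \<rho> (?r \<beta>)) \<le> \<rho> $ j * 1"
      by (intro mult_left_mono B_set_nonneg \<rho>)
    then show "(\<Sum>\<beta>\<in>?F. \<rho> $ j * mi_coeff \<rho> (?r \<beta>)) \<le> \<rho> $ j * 1"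
      by (simp add: sum_distrib_left)
  qed
  also have "\<dots> \<le> 1" using \<rho> by (simp add: B_set_def)
  finally show ?case .
qed

lemma mi_coeff_le_1: "\<rho> \<in> B_set \<Longrightarrow> mi_coeff \<rho> \<alpha> \<le> 1"
  using sum_mi_coeff_le_1[of \<rho> "{\<alpha>}" "mi_abs \<alpha>"] by simp

text \<open>Partial sums of the negative binomial series. Pascal's rule bounds the sum for
  \<open>Suc a\<close> by the sum for \<open>a\<close> plus \<open>q\<close> times itself; solving
  for it produces one more factor \<open>1 / (1 - q)\<close>.\<close>

lemma sum_binomial_power_le:
  fixes q :: real
  assumes "0 \<le> q" "q < 1"
  shows "(\<Sum>k<N. real ((a + k) choose k) * q ^ k) \<le> 1 / (1 - q) ^ (a + 1)"
proof (induction a)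
  case 0
  have "(\<Sum>k<N. q ^ k) * (1 - q) \<le> 1"
    using assms by (simp add: sum_gp_strict)
  then show ?case using assms by (simp add: field_simps)
next
  case (Suc a)
  let ?S = "\<lambda>a N. \<Sum>k<N. real ((a + k) choose k) * q ^ k"
  have rec: "?S (Suc a) N \<le> ?S a N + q * ?S (Suc a) N" for N
  proof (cases N)
    case (Suc n)
    have "?S (Suc a) (Suc n) = 1 + (\<Sum>k<n. real ((a + Suc k) choose Suc k) * q ^ Suc k)
        + (\<Sum>k<n. real ((Suc a + k) choose k) * q ^ Suc k)"
      by (simp add: sum.lessThan_Suc_shift distrib_right sum.distrib del: sum.lessThan_Suc)
    also have "\<dots> = ?S a (Suc n) + q * ?S (Suc a) n"
      by (simp add: sum.lessThan_Suc_shift sum_distrib_left mult_ac del: sum.lessThan_Suc)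
    also have "\<dots> \<le> ?S a (Suc n) + q * ?S (Suc a) (Suc n)"
      using assms by (intro add_left_mono mult_left_mono) auto
    finally show ?thesis unfolding Suc .
  qed simp
  have "?S (Suc a) N * (1 - q) \<le> 1 / (1 - q) ^ (a + 1)"
    using rec[of N] Suc.IH by (simp add: algebra_simps)
  then have "?S (Suc a) N \<le> 1 / (1 - q) ^ (a + 1) / (1 - q)"
    using assms by (subst pos_le_divide_eq) auto
  then show ?case by (simp add: mult.commute)
qed

text \<open>The combined factorial quotient is a binomial coefficient in the two degrees times two
  multinomial terms. Grouping by the degree of \<open>\<beta>\<close> leaves a negative binomial
  series. The case \<open>q = 1/2\<close> serves the limit operator,
  \<open>q = \<delta> / (1 + 2 * \<delta>)\<close> the error.\<close>

lemma mi_row_sum_le: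
  assumes \<rho>: "\<rho> \<in> B_set" and q: "0 \<le> q" "q \<le> 1/2" and F: "finite F"
  shows "(\<Sum>\<beta>\<in>F. fact (mi_abs \<alpha> + mi_abs \<beta>) * q ^ (mi_abs \<alpha> + mi_abs \<beta>)
      * mi_power \<rho> \<alpha> * mi_power \<rho> \<beta> / (mi_fact \<alpha> * mi_fact \<beta>)) \<le> 2"
proof -
  define a where "a = mi_abs \<alpha>"
  define c where "c = (\<lambda>k. real ((a + k) choose k) * q ^ (a + k))"
  have c0: "0 \<le> c k" for k unfolding c_def using q by simp
  have "(\<Sum>\<beta>\<in>F. fact (mi_abs \<alpha> + mi_abs \<beta>) * q ^ (mi_abs \<alpha> + mi_abs \<beta>)
      * mi_power \<rho> \<alpha> * mi_power \<rho> \<beta> / (mi_fact \<alpha> * mi_fact \<beta>)) =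
      mi_coeff \<rho> \<alpha> * (\<Sum>\<beta>\<in>F. c (mi_abs \<beta>) * mi_coeff \<rho> \<beta>)"
    unfolding sum_distrib_left
    by (intro sum.cong refl) (simp add: c_def a_def mi_coeff_def binomial_fact)
  also have "\<dots> \<le> 1 * (\<Sum>\<beta>\<in>F. c (mi_abs \<beta>) * mi_coeff \<rho> \<beta>)"
    by (intro mult_right_mono sum_nonneg mult_nonneg_nonneg c0 mi_coeff_nonneg mi_coeff_le_1 \<rho>)
  also have "\<dots> = (\<Sum>k\<in>mi_abs ` F. \<Sum>\<beta> | \<beta> \<in> F \<and> mi_abs \<beta> = k. c (mi_abs \<beta>) * mi_coeff \<rho> \<beta>)"
    using sum.image_gen[OF F, of "\<lambda>\<beta>. c (mi_abs \<beta>) * mi_coeff \<rho> \<beta>" mi_abs] by simp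
  also have "\<dots> = (\<Sum>k\<in>mi_abs ` F. c k * (\<Sum>\<beta> | \<beta> \<in> F \<and> mi_abs \<beta> = k. mi_coeff \<rho> \<beta>))"
    unfolding sum_distrib_left by (intro sum.cong refl) auto
  also have "\<dots> \<le> (\<Sum>k\<in>mi_abs ` F. c k * 1)"
    using F by (intro sum_mono mult_left_mono sum_mi_coeff_le_1[OF \<rho>] c0) auto
  also have "\<dots> \<le> (\<Sum>k<Suc (Max (mi_abs ` F)). c k * 1)"
    using F c0 by (intro sum_mono2) (auto simp: less_Suc_eq_le)
  also have "\<dots> = q ^ a * (\<Sum>k<Suc (Max (mi_abs ` F)). real ((a + k) choose k) * q ^ k)"
    unfolding sum_distrib_left c_def by (intro sum.cong refl) (simp add: power_add mult_ac)
  also have "\<dots> \<le> q ^ a * (1 / (1 - q) ^ (a + 1))"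
    using q by (intro mult_left_mono sum_binomial_power_le) auto
  \<comment> \<open>Here \<open>q \<le> 1/2\<close> enters as \<open>q \<le> 1 - q\<close>; the
    powers with exponent \<open>a\<close> cancel, and the bound becomes independent of
    \<open>\<alpha>\<close>.\<close>
  also have "\<dots> \<le> (1 - q) ^ a * (1 / (1 - q) ^ (a + 1))"
    using q by (intro mult_right_mono power_mono) auto
  also have "\<dots> = 1 / (1 - q)" using q by simp
  also have "\<dots> \<le> 2" using q by (simp add: field_simps)
  finally show ?thesis .
qed

section \<open>The coefficient operator and its Gram matrix\<close>

lemma infsum_exp:
  fixes z :: "'a::{real_normed_field, banach}"
  shows "(\<lambda>n. norm (z ^ n / fact n)) summable_on UNIV" "(\<Sum>\<^sub>\<infinity>n. z ^ n / fact n) = exp z"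
proof -
  have eq: "z ^ n /\<^sub>R fact n = z ^ n / fact n" for n
    by (simp add: scaleR_conv_of_real divide_inverse mult.commute)
  have s: "summable (\<lambda>n. norm (z ^ n / fact n))" using summable_norm_exp[of z] by (simp add: eq)
  then show "(\<lambda>n. norm (z ^ n / fact n)) summable_on UNIV"
    by (rule summable_nonneg_imp_summable_on) simp
  have "((\<lambda>n. z ^ n / fact n) has_sum exp z) UNIV"
    using s exp_converges[of z] unfolding eq by (rule norm_summable_imp_has_sum)
  then show "(\<Sum>\<^sub>\<infinity>n. z ^ n / fact n) = exp z" by (rule infsumI)
qed

lemma infsum_multi_exp:
  fixes z :: "'d::finite \<Rightarrow> 'a::{real_normed_field, banach}"
  shows "(\<Sum>\<^sub>\<infinity>\<alpha>. \<Prod>j\<in>UNIV. z j ^ \<alpha> j / fact (\<alpha> j)) = exp (\<Sum>j\<in>UNIV. z j)"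
  using infsum_prod_PiE_abs[of UNIV "\<lambda>j n. z j ^ n / fact n" "\<lambda>_. UNIV"]
  by (simp add: infsum_exp exp_sum)

lemma multi_exp_sum_le:
  fixes z :: "'d::finite \<Rightarrow> real"
  assumes "\<And>j. 0 \<le> z j" "finite F"
  shows "(\<Sum>\<alpha>\<in>F. \<Prod>j\<in>UNIV. z j ^ \<alpha> j / fact (\<alpha> j)) \<le> exp (\<Sum>j\<in>UNIV. z j)"
proof -
  have "(\<lambda>\<alpha>. \<Prod>j\<in>UNIV. z j ^ \<alpha> j / fact (\<alpha> j)) summable_on UNIV"
  \<comment> \<open>A family that is not summable has \<open>infsum\<close> equal to 0, whereas the
    value here is an exponential.\<close>
  proof (rule ccontr)
    assume "\<not> ?thesis"
    from infsum_not_exists[OF this] show False unfolding infsum_multi_exp by simp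
  qed
  then show ?thesis unfolding infsum_multi_exp[symmetric]
    using assms by (intro finite_sum_le_infsum) (auto intro!: prod_nonneg)
qed

lemma mi_monomial:
  fixes t :: real
  shows "t ^ mi_abs \<alpha> * mi_power \<rho> \<alpha> / mi_fact \<alpha> = (\<Prod>j\<in>UNIV. (t * \<rho> $ j) ^ \<alpha> j / fact (\<alpha> j))"
  by (simp add: mi_abs_def mi_power_def mi_fact_def power_sum prod.distrib[symmetric]
      prod_dividef power_mult_distrib)

section \<open>The kernel of the coefficient operator\<close>

definition T_kernel :: "real \<Rightarrow> real^'d \<Rightarrow> 'd::finite multi_index \<Rightarrow> nat \<Rightarrow> real" where
  "T_kernel \<delta> \<rho> \<alpha> n = real (Suc n) powr (- 1/2 - \<delta>)
     * ((- \<delta> * ln (real (Suc n))) ^ mi_abs \<alpha> * mi_power \<rho> \<alpha> / mi_fact \<alpha>)"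

lemma mi_power_nonneg: "\<rho> \<in> B_set \<Longrightarrow> 0 \<le> mi_power \<rho> \<alpha>"
  unfolding mi_power_def by (intro prod_nonneg) (simp add: B_set_nonneg)

lemma abs_T_kernel:
  assumes "\<rho> \<in> B_set" "0 < \<delta>"
  shows "\<bar>T_kernel \<delta> \<rho> \<alpha> n\<bar> = real (Suc n) powr (- 1/2 - \<delta>)
     * ((\<delta> * ln (real (Suc n))) ^ mi_abs \<alpha> * mi_power \<rho> \<alpha> / mi_fact \<alpha>)"
  using assms mi_fact_pos[of \<alpha>] mi_power_nonneg[OF assms(1), of \<alpha>]
  unfolding T_kernel_def by (simp add: abs_mult power_abs)

text \<open>The moduli in a column are terms of a multivariate exponential series. As the
  coordinates of \<open>\<rho>\<close> add up to at most 1, its sum is at most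
  \<open>real (Suc n) powr \<delta>\<close>, which cancels the decay in
  \<open>\<delta>\<close>.\<close>

lemma T_kernel_column_sum:
  fixes \<rho> :: "real^'d"
  assumes \<rho>: "\<rho> \<in> B_set" and \<delta>: "0 < \<delta>" and F: "finite F"
  shows "(\<Sum>\<alpha>\<in>F. \<bar>T_kernel \<delta> \<rho> \<alpha> n\<bar>) \<le> real (Suc n) powr (- 1/2)"
proof -
  define t where "t = \<delta> * ln (real (Suc n))"
  have t: "0 \<le> t" unfolding t_def using \<delta> by simp
  have "(\<Sum>\<alpha>\<in>F. \<bar>T_kernel \<delta> \<rho> \<alpha> n\<bar>) = real (Suc n) powr (- 1/2 - \<delta>)
      * (\<Sum>\<alpha>\<in>F. \<Prod>j\<in>UNIV. (t * \<rho> $ j) ^ \<alpha> j / fact (\<alpha> j))"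
    unfolding sum_distrib_left abs_T_kernel[OF \<rho> \<delta>] t_def[symmetric] mi_monomial ..
  also have "\<dots> \<le> real (Suc n) powr (- 1/2 - \<delta>) * exp (\<Sum>j\<in>UNIV. t * \<rho> $ j)"
    using t B_set_nonneg[OF \<rho>] by (intro mult_left_mono multi_exp_sum_le F) auto
  also have "\<dots> \<le> real (Suc n) powr (- 1/2 - \<delta>) * exp t"
    using \<rho> t by (intro mult_left_mono)
      (auto simp: B_set_def sum_distrib_left[symmetric] mult_left_le)
  also have "exp t = real (Suc n) powr \<delta>" unfolding t_def powr_def by simp
  also have "real (Suc n) powr (- 1/2 - \<delta>) * \<dots> = real (Suc n) powr (- 1/2)"
    by (simp add: powr_add[symmetric])
  finally show ?thesis .
qed

text \<open>The weight turns the row into a multiple of the logarithmic series with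
  \<open>s = \<delta>\<close>. Its leading part \<open>fact m / \<delta> ^ (m + 1)\<close> combines
  with the coefficient into \<open>mi_coeff \<rho> \<alpha> / \<delta>\<close>, and
  \<open>mi_coeff\<close> is at most 1.\<close>

lemma T_kernel_row_sum:
  fixes \<rho> :: "real^'d"
  assumes \<rho>: "\<rho> \<in> B_set" and \<delta>: "0 < \<delta>" and G: "finite G"
  shows "(\<Sum>n\<in>G. \<bar>T_kernel \<delta> \<rho> \<alpha> n\<bar> * real (Suc n) powr (- 1/2)) \<le> 1 / \<delta> + 2"
proof -
  define m where "m = mi_abs \<alpha>"
  define f where "f = (\<lambda>n. real (Suc n) powr (- 1 - \<delta>) * ln (real (Suc n)) ^ m)"
  note f = sum_ln_power[OF \<delta>, of m, folded f_def]
  define c where "c = \<delta> ^ m * mi_power \<rho> \<alpha> / mi_fact \<alpha>"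
  have c: "0 \<le> c" unfolding c_def
    using \<delta> mi_fact_pos[of \<alpha>] mi_power_nonneg[OF \<rho>, of \<alpha>] by simp
  have "\<bar>T_kernel \<delta> \<rho> \<alpha> n\<bar> * real (Suc n) powr (- 1/2) = c * f n" for n
  proof -
    have "real (Suc n) powr (- 1/2 - \<delta>) * real (Suc n) powr (- 1/2) = real (Suc n) powr (- 1 - \<delta>)"
      by (simp add: powr_add[symmetric])
    moreover have "\<bar>T_kernel \<delta> \<rho> \<alpha> n\<bar> * real (Suc n) powr (- 1/2) =
        (real (Suc n) powr (- 1/2 - \<delta>) * real (Suc n) powr (- 1/2)) * (c * ln (real (Suc n)) ^ m)"
      unfolding abs_T_kernel[OF \<rho> \<delta>] c_def m_def power_mult_distrib by simp
    ultimately show ?thesis unfolding f_def by simp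
  qed
  then have "(\<Sum>n\<in>G. \<bar>T_kernel \<delta> \<rho> \<alpha> n\<bar> * real (Suc n) powr (- 1/2)) = c * (\<Sum>n\<in>G. f n)"
    by (simp add: sum_distrib_left)
  also have "\<dots> \<le> c * suminf f"
    by (intro mult_left_mono sum_le_suminf c f G) (simp add: f_def)
  also have "\<dots> \<le> c * (fact m / \<delta> ^ (m + 1) + 2 * fact m / (1 + \<delta>) ^ m)"
    using f(2) by (intro mult_left_mono c) linarith
  also have "\<dots> = mi_power \<rho> \<alpha> / mi_fact \<alpha> *
      (\<delta> ^ m * (fact m / \<delta> ^ (m + 1) + 2 * fact m / (1 + \<delta>) ^ m))"
    unfolding c_def by simp
  also have "\<delta> ^ m * (fact m / \<delta> ^ (m + 1) + 2 * fact m / (1 + \<delta>) ^ m) =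
      fact m * (1 / \<delta> + 2 * (\<delta> / (1 + \<delta>)) ^ m)"
    using \<delta> by (simp add: distrib_left power_divide)
  also have "mi_power \<rho> \<alpha> / mi_fact \<alpha> * \<dots> = mi_coeff \<rho> \<alpha> * (1 / \<delta> + 2 * (\<delta> / (1 + \<delta>)) ^ m)"
    unfolding mi_coeff_def m_def by simp
  also have "\<dots> \<le> 1 * (1 / \<delta> + 2 * 1)"
    using \<delta> by (intro mult_mono mi_coeff_le_1 \<rho> add_left_mono mult_left_mono power_le_one) auto
  finally show ?thesis by simp
qed

text \<open>Schur test with weight \<open>real (Suc n) powr (- 1/2)\<close> in \<open>n\<close> and
  1 in \<open>\<alpha>\<close>. Without a weight, the row of index 0 already has a divergent sum for
  \<open>\<delta> \<le> 1/2\<close>.\<close>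

lemma bounded_T_kernel:
  assumes "\<rho> \<in> B_set" "0 < \<delta>"
  shows "bounded_kernel (\<lambda>\<alpha> n. of_real (T_kernel \<delta> \<rho> \<alpha> n)) (sqrt (1 * (1 / \<delta> + 2)))"
  using assms T_kernel_column_sum[OF assms] T_kernel_row_sum[OF assms]
  by (intro schur_test[of "\<lambda>n. real (Suc n) powr (- 1/2)" "\<lambda>_. 1"]) simp_all

lemma coeff_operator_eq:
  assumes "\<rho> \<in> B_set" "0 < \<delta>"
  shows "coeff_operator \<delta> \<rho> = kernel_op (\<lambda>\<alpha> n. of_real (T_kernel \<delta> \<rho> \<alpha> n))"
  unfolding coeff_operator_def T_kernel_def[symmetric]
proof (rule the_equality)
  let ?T = "kernel_op (\<lambda>\<alpha> n. of_real (T_kernel \<delta> \<rho> \<alpha> n))"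
  have sums: "coord (blinfun_apply ?T a) \<alpha> = (\<Sum>n. coord a n * of_real (T_kernel \<delta> \<rho> \<alpha> n))" for a \<alpha>
    using has_sum_imp_sums[OF coord_kernel_op_has_sum[OF bounded_T_kernel[OF assms], of \<alpha> a]]
    by (simp add: sums_iff mult.commute)
  then show "\<forall>a \<alpha>. coord (blinfun_apply ?T a) \<alpha> = (\<Sum>n. coord a n * of_real (T_kernel \<delta> \<rho> \<alpha> n))"
    by blast
  fix T
  assume "\<forall>a \<alpha>. coord (blinfun_apply T a) \<alpha> = (\<Sum>n. coord a n * of_real (T_kernel \<delta> \<rho> \<alpha> n))"
  then show "T = ?T" by (intro blinfun_eqI ell2_eqI) (simp add: sums)
qed

section \<open>The limit operator\<close>

lemma H_entry_eq:
  "H_entry \<rho> \<alpha> \<beta> = (-1) ^ (mi_abs \<alpha> + mi_abs \<beta>) * (fact (mi_abs \<alpha> + mi_abs \<beta>)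
    * (1/2) ^ (mi_abs \<alpha> + mi_abs \<beta>) * mi_power \<rho> \<alpha> * mi_power \<rho> \<beta> / (mi_fact \<alpha> * mi_fact \<beta>))"
proof -
  have "(\<Prod>j\<in>UNIV. (\<rho> $ j / 2) ^ (\<alpha> j + \<beta> j)) =
      (1/2) ^ (mi_abs \<alpha> + mi_abs \<beta>) * mi_power \<rho> \<alpha> * mi_power \<rho> \<beta>"
    by (simp add: mi_abs_def mi_power_def power_sum power_add power_divide prod_dividef prod.distrib)
  then show ?thesis unfolding H_entry_def by simp
qed

lemma bounded_H_kernel:
  fixes \<rho> :: "real^'d::finite"
  assumes \<rho>: "\<rho> \<in> B_set"
  shows "bounded_kernel (\<lambda>\<alpha> \<beta>. of_real (H_entry \<rho> \<alpha> \<beta>)) 2"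
proof (rule schur_test_symmetric)
  have abs: "\<bar>H_entry \<rho> \<alpha> \<beta>\<bar> = fact (mi_abs \<alpha> + mi_abs \<beta>) * (1/2) ^ (mi_abs \<alpha> + mi_abs \<beta>)
      * mi_power \<rho> \<alpha> * mi_power \<rho> \<beta> / (mi_fact \<alpha> * mi_fact \<beta>)" for \<alpha> \<beta>
    using mi_fact_pos[of \<alpha>] mi_fact_pos[of \<beta>] mi_power_nonneg[OF \<rho>, of \<alpha>] mi_power_nonneg[OF \<rho>, of \<beta>]
    unfolding H_entry_eq by (simp add: abs_mult power_abs)
  show "cmod (of_real (H_entry \<rho> \<alpha> \<beta>)) = cmod (of_real (H_entry \<rho> \<beta> \<alpha>))" for \<alpha> \<beta>
    by (simp add: H_entry_eq add.commute mult.commute mult.left_commute)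
  show "(\<Sum>\<beta>\<in>G. cmod (of_real (H_entry \<rho> \<alpha> \<beta>))) \<le> 2" if "finite G" for G \<alpha>
    unfolding norm_of_real abs by (rule mi_row_sum_le[OF \<rho> _ _ that]) auto
qed simp

lemma H_operator_eq:
  fixes \<rho> :: "real^'d::finite"
  assumes "\<rho> \<in> B_set"
  shows "H_operator \<rho> = kernel_op (\<lambda>\<alpha> \<beta>. of_real (H_entry \<rho> \<alpha> \<beta>))"
  unfolding H_operator_def
proof (rule the_equality)
  note co = coord_kernel_op[OF bounded_H_kernel[OF assms]]
  show "\<forall>x \<alpha>. coord (kernel_op (\<lambda>\<alpha> \<beta>. of_real (H_entry \<rho> \<alpha> \<beta>)) x) \<alpha> =
      (\<Sum>\<^sub>\<infinity>\<beta>. of_real (H_entry \<rho> \<alpha> \<beta>) * coord x \<beta>)"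
    by (simp add: co)
  fix H :: "'d multi_index ell2 \<Rightarrow>\<^sub>L 'd multi_index ell2"
  assume "\<forall>x \<alpha>. coord (blinfun_apply H x) \<alpha> = (\<Sum>\<^sub>\<infinity>\<beta>. of_real (H_entry \<rho> \<alpha> \<beta>) * coord x \<beta>)"
  then show "H = kernel_op (\<lambda>\<alpha> \<beta>. of_real (H_entry \<rho> \<alpha> \<beta>))"
    by (intro blinfun_eqI ell2_eqI) (simp add: co)
qed

section \<open>Entries of the Gram matrix and their distance from the limit\<close>

definition A_entry :: "real \<Rightarrow> real^'d \<Rightarrow> 'd::finite multi_index \<Rightarrow> 'd multi_index \<Rightarrow> real" where
  "A_entry \<delta> \<rho> \<alpha> \<beta> = (- \<delta>) ^ (mi_abs \<alpha> + mi_abs \<beta>) * mi_power \<rho> \<alpha> * mi_power \<rho> \<beta> / (mi_fact \<alpha> * mi_fact \<beta>)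
     * (\<Sum>n. real (Suc n) powr (- 1 - 2 * \<delta>) * ln (real (Suc n)) ^ (mi_abs \<alpha> + mi_abs \<beta>))"

text \<open>Each of the two rows contributes the exponent \<open>- 1/2 - \<delta>\<close>, so the
  logarithmic series appears with \<open>s = 2 * \<delta>\<close> and power the sum of the two
  degrees.\<close>

lemma infsum_T_kernel:
  assumes \<delta>: "0 < \<delta>"
  shows "(\<Sum>\<^sub>\<infinity>n. of_real (T_kernel \<delta> \<rho> \<alpha> n) * cnj (of_real (T_kernel \<delta> \<rho> \<beta> n))) =
    complex_of_real (A_entry \<delta> \<rho> \<alpha> \<beta>)"
proof -
  define m where "m = mi_abs \<alpha> + mi_abs \<beta>"
  define c where "c = (- \<delta>) ^ m * mi_power \<rho> \<alpha> * mi_power \<rho> \<beta> / (mi_fact \<alpha> * mi_fact \<beta>)"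
  define f where "f = (\<lambda>n. real (Suc n) powr (- 1 - 2 * \<delta>) * ln (real (Suc n)) ^ m)"
  have "summable f" unfolding f_def using sum_ln_power(1)[of "2 * \<delta>" m] \<delta> by simp
  then have "(f has_sum suminf f) UNIV"
    by (intro sums_nonneg_imp_has_sum summable_sums) (auto simp: f_def)
  then have "((\<lambda>n. complex_of_real (c * f n)) has_sum complex_of_real (c * suminf f)) UNIV"
    by (intro has_sum_of_real has_sum_cmult_right)
  moreover have "of_real (T_kernel \<delta> \<rho> \<alpha> n) * cnj (of_real (T_kernel \<delta> \<rho> \<beta> n)) = complex_of_real (c * f n)" for n
  proof -
    have "real (Suc n) powr (- 1/2 - \<delta>) * real (Suc n) powr (- 1/2 - \<delta>) = real (Suc n) powr (- 1 - 2 * \<delta>)"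
      by (simp add: powr_add[symmetric])
    moreover have "(- \<delta> * ln (real (Suc n))) ^ mi_abs \<alpha> * (- \<delta> * ln (real (Suc n))) ^ mi_abs \<beta> =
        (- \<delta>) ^ m * ln (real (Suc n)) ^ m"
      unfolding m_def by (simp only: power_add power_mult_distrib mult_ac)
    ultimately have "c * f n = (real (Suc n) powr (- 1/2 - \<delta>) * real (Suc n) powr (- 1/2 - \<delta>)) *
        ((- \<delta> * ln (real (Suc n))) ^ mi_abs \<alpha> * (- \<delta> * ln (real (Suc n))) ^ mi_abs \<beta>) *
        (mi_power \<rho> \<alpha> * mi_power \<rho> \<beta> / (mi_fact \<alpha> * mi_fact \<beta>))"
      unfolding c_def f_def by simp
    also have "\<dots> = T_kernel \<delta> \<rho> \<alpha> n * T_kernel \<delta> \<rho> \<beta> n"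
      unfolding T_kernel_def by simp
    finally show ?thesis by simp
  qed
  ultimately show ?thesis unfolding A_entry_def m_def c_def f_def by (simp add: infsumI)
qed

lemma abs_A_entry_minus_H_entry:
  fixes \<rho> :: "real^'d::finite"
  assumes \<rho>: "\<rho> \<in> B_set" and \<delta>: "0 < \<delta>"
  shows "\<bar>2 * \<delta> * A_entry \<delta> \<rho> \<alpha> \<beta> - H_entry \<rho> \<alpha> \<beta>\<bar> \<le> 4 * \<delta> *
    (fact (mi_abs \<alpha> + mi_abs \<beta>) * (\<delta> / (1 + 2 * \<delta>)) ^ (mi_abs \<alpha> + mi_abs \<beta>)
      * mi_power \<rho> \<alpha> * mi_power \<rho> \<beta> / (mi_fact \<alpha> * mi_fact \<beta>))"
proof -
  define m where "m = mi_abs \<alpha> + mi_abs \<beta>"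
  define r where "r = mi_power \<rho> \<alpha> * mi_power \<rho> \<beta> / (mi_fact \<alpha> * mi_fact \<beta>)"
  define S where "S = (\<Sum>n. real (Suc n) powr (- 1 - 2 * \<delta>) * ln (real (Suc n)) ^ m)"
  have r: "0 \<le> r" unfolding r_def
    using mi_fact_pos[of \<alpha>] mi_fact_pos[of \<beta>] mi_power_nonneg[OF \<rho>, of \<alpha>] mi_power_nonneg[OF \<rho>, of \<beta>]
    by simp
  have A: "A_entry \<delta> \<rho> \<alpha> \<beta> = (- \<delta>) ^ m * r * S" unfolding A_entry_def m_def r_def S_def by simp
  \<comment> \<open>This has the shape of
    \<open>2 * \<delta> * A_entry \<delta> \<rho> \<alpha> \<beta>\<close> with the series
    \<open>S\<close> replaced by the corresponding integral; all powers of \<open>\<delta>\<close>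
    cancel.\<close>
  have H: "H_entry \<rho> \<alpha> \<beta> = 2 * \<delta> * ((- \<delta>) ^ m * r * (fact m / (2 * \<delta>) ^ (m + 1)))"
  proof -
    have "(-1) ^ m * (1/2) ^ m = 2 * \<delta> * ((- \<delta>) ^ m / (2 * \<delta>) ^ (m + 1))"
      using \<delta> by (simp add: power_mult_distrib power_minus[of \<delta>] field_simps)
    then show ?thesis unfolding H_entry_eq m_def[symmetric] r_def by (simp add: algebra_simps)
  qed
  have "\<bar>2 * \<delta> * A_entry \<delta> \<rho> \<alpha> \<beta> - H_entry \<rho> \<alpha> \<beta>\<bar> =
      2 * \<delta> * \<delta> ^ m * r * \<bar>S - fact m / (2 * \<delta>) ^ (m + 1)\<bar>"
  proof -
    have "2 * \<delta> * A_entry \<delta> \<rho> \<alpha> \<beta> - H_entry \<rho> \<alpha> \<beta> =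
        2 * \<delta> * (- \<delta>) ^ m * r * (S - fact m / (2 * \<delta>) ^ (m + 1))"
      unfolding A H by (simp only: right_diff_distrib mult.assoc)
    then show ?thesis using \<delta> r by (simp add: abs_mult power_abs)
  qed
  also have "\<dots> \<le> 2 * \<delta> * \<delta> ^ m * r * (2 * fact m / (1 + 2 * \<delta>) ^ m)"
    using sum_ln_power(2)[of "2 * \<delta>" m] \<delta> r unfolding S_def by (intro mult_left_mono) simp_all
  also have "\<dots> = 4 * \<delta> * (fact m * (\<delta> / (1 + 2 * \<delta>)) ^ m * r)"
    by (simp add: power_divide)
  finally show ?thesis unfolding m_def r_def by simp
qed

lemma norm_A_operator_minus_H_operator_le:
  fixes \<rho> :: "real^'d::finite"
  assumes \<rho>: "\<rho> \<in> B_set" and \<delta>: "0 < \<delta>"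
  shows "norm ((2 * \<delta>) *\<^sub>R A_operator \<delta> \<rho> - H_operator \<rho>) \<le> 8 * \<delta>"
proof -
  define D where "D = (\<lambda>\<alpha> \<beta>. complex_of_real (2 * \<delta> * A_entry \<delta> \<rho> \<alpha> \<beta> - H_entry \<rho> \<alpha> \<beta>))"
  have D: "bounded_kernel D (8 * \<delta>)"
  proof (rule schur_test_symmetric)
    show "cmod (D \<alpha> \<beta>) = cmod (D \<beta> \<alpha>)" for \<alpha> \<beta>
      unfolding D_def H_entry_eq A_entry_def
      by (simp add: add.commute mult.commute mult.left_commute)
    show "(\<Sum>\<beta>\<in>G. cmod (D \<alpha> \<beta>)) \<le> 8 * \<delta>" if "finite G" for G \<alpha>
    proof -
      let ?b = "\<lambda>\<beta>. fact (mi_abs \<alpha> + mi_abs \<beta>) * (\<delta> / (1 + 2 * \<delta>)) ^ (mi_abs \<alpha> + mi_abs \<beta>)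
        * mi_power \<rho> \<alpha> * mi_power \<rho> \<beta> / (mi_fact \<alpha> * mi_fact \<beta>)"
      have "(\<Sum>\<beta>\<in>G. cmod (D \<alpha> \<beta>)) \<le> (\<Sum>\<beta>\<in>G. 4 * \<delta> * ?b \<beta>)"
        unfolding D_def norm_of_real by (intro sum_mono abs_A_entry_minus_H_entry \<rho> \<delta>)
      also have "\<dots> = 4 * \<delta> * (\<Sum>\<beta>\<in>G. ?b \<beta>)" by (simp add: sum_distrib_left)
      \<comment> \<open>The ratio \<open>\<delta> / (1 + 2 * \<delta>)\<close> is below 1/2, so the
        row sum bound 2 applies; this is the origin of the constant 8.\<close>
      also have "\<dots> \<le> 4 * \<delta> * 2"
        using \<delta> by (intro mult_left_mono mi_row_sum_le[OF \<rho> _ _ that]) (auto simp: field_simps)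
      finally show ?thesis by simp
    qed
  qed (use \<delta> in simp)
  note T = bounded_T_kernel[OF \<rho> \<delta>]
  have "(2 * \<delta>) *\<^sub>R A_operator \<delta> \<rho> - H_operator \<rho> = kernel_op D"
  proof (intro blinfun_eqI ell2_eqI)
    fix x \<alpha>
    have "((\<lambda>\<beta>. of_real (A_entry \<delta> \<rho> \<alpha> \<beta>) * coord x \<beta>) has_sum coord (A_operator \<delta> \<rho> x) \<alpha>) UNIV"
      using kernel_op_compose_adjoint_has_sum[OF T, of \<alpha> x]
      unfolding infsum_T_kernel[OF \<delta>] A_operator_def coeff_operator_eq[OF \<rho> \<delta>]
        hilbert_adjoint_kernel_op[OF T] .
    moreover have "((\<lambda>\<beta>. of_real (H_entry \<rho> \<alpha> \<beta>) * coord x \<beta>) has_sum coord (H_operator \<rho> x) \<alpha>) UNIV"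
      unfolding H_operator_eq[OF \<rho>] by (rule coord_kernel_op_has_sum[OF bounded_H_kernel[OF \<rho>]])
    ultimately have "((\<lambda>\<beta>. of_real (2 * \<delta>) * (of_real (A_entry \<delta> \<rho> \<alpha> \<beta>) * coord x \<beta>)
        + - (of_real (H_entry \<rho> \<alpha> \<beta>) * coord x \<beta>)) has_sum
        of_real (2 * \<delta>) * coord (A_operator \<delta> \<rho> x) \<alpha> + - coord (H_operator \<rho> x) \<alpha>) UNIV"
      by (intro has_sum_add has_sum_cmult_right has_sum_uminusI)
    then have "((\<lambda>\<beta>. D \<alpha> \<beta> * coord x \<beta>) has_sum
        of_real (2 * \<delta>) * coord (A_operator \<delta> \<rho> x) \<alpha> + - coord (H_operator \<rho> x) \<alpha>) UNIV"
      by (simp add: D_def algebra_simps)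
    from has_sum_unique[OF this coord_kernel_op_has_sum[OF D]]
    show "coord (((2 * \<delta>) *\<^sub>R A_operator \<delta> \<rho> - H_operator \<rho>) x) \<alpha> = coord (kernel_op D x) \<alpha>"
      by (simp add: blinfun.diff_left blinfun.scaleR_left minus_ell2.rep_eq scaleR_ell2.rep_eq
          scaleR_conv_of_real)
  qed
  then show ?thesis using norm_kernel_op_le[OF D] by simp
qed

lemma norm_A_operator:
  assumes \<rho>: "\<rho> \<in> B_set" and \<delta>: "0 < \<delta>"
  shows "norm (A_operator \<delta> \<rho>) = (norm (coeff_operator \<delta> \<rho>))\<^sup>2"
  unfolding A_operator_def coeff_operator_eq[OF \<rho> \<delta>]
    hilbert_adjoint_kernel_op[OF bounded_T_kernel[OF \<rho> \<delta>]]
  by (intro norm_compose_adjoint cinner_kernel_op[OF bounded_T_kernel[OF \<rho> \<delta>]])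

section \<open>Dirichlet series and composition operators\<close>

lemma nat_powr_complex: "of_nat (Suc n) powr s = exp (s * complex_of_real (ln (real (Suc n))))"
proof -
  have "Ln (of_nat (Suc n)) = complex_of_real (ln (real (Suc n)))"
    using Ln_of_real[of "real (Suc n)"] by simp
  then show ?thesis unfolding powr_def by (simp del: of_nat_Suc)
qed

lemma cmod_nat_powr: "cmod (of_nat (Suc n) powr s) = real (Suc n) powr Re s"
  unfolding nat_powr_complex by (simp add: powr_def del: of_nat_Suc)

lemma nat_powr_square_summable:
  assumes "Re s > 1/2"
  shows "(\<lambda>n. (cmod (of_nat (Suc n) powr (- s)))\<^sup>2) summable_on UNIV"
proof (rule summable_nonneg_imp_summable_on)
  have "summable (\<lambda>n. real n powr (- 2 * Re s))"
    using assms by (subst summable_real_powr_iff) simp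
  then have "summable (\<lambda>n. real (Suc n) powr (- 2 * Re s))" by (subst summable_Suc_iff)
  moreover have "(cmod (of_nat (Suc n) powr (- s)))\<^sup>2 = real (Suc n) powr (- 2 * Re s)" for n
    unfolding cmod_nat_powr power2_eq_square powr_add[symmetric] by simp
  ultimately show "summable (\<lambda>n. (cmod (of_nat (Suc n) powr (- s)))\<^sup>2)" by simp
qed simp

lemma dirichlet_abs_summable_on:
  assumes "Re s > 1/2"
  shows "(\<lambda>n. cmod (coord f n * of_nat (Suc n) powr (- s))) summable_on UNIV"
proof -
  have "(\<lambda>n. coord f n * cnj (cnj (of_nat (Suc n) powr (- s)))) summable_on UNIV"
    using nat_powr_square_summable[OF assms]
    by (intro ell2_summable_mult coord_cmod_summable) simp
  then have "(\<lambda>n. coord f n * of_nat (Suc n) powr (- s)) summable_on UNIV" by simp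
  then show ?thesis by (simp only: summable_on_iff_abs_summable_on_complex)
qed

lemma dirichlet_eval_infsum:
  assumes "Re s > 1/2"
  shows "dirichlet_eval f s = (\<Sum>\<^sub>\<infinity>n. coord f n * of_nat (Suc n) powr (- s))"
  unfolding dirichlet_eval_def
  using has_sum_imp_sums[OF has_sum_infsum[OF abs_summable_summable[OF dirichlet_abs_summable_on[OF assms, of f]]]]
  by (simp only: sums_iff)

lemma dirichlet_eval_diff:
  assumes "Re s > 1/2"
  shows "dirichlet_eval (f - g) s = dirichlet_eval f s - dirichlet_eval g s"
proof -
  have "summable (\<lambda>n. coord h n * of_nat (Suc n) powr (- s))" for h
    using summable_on_imp_summable[OF abs_summable_summable[OF dirichlet_abs_summable_on[OF assms]]] .
  from suminf_diff[OF this this] show ?thesis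
    unfolding dirichlet_eval_def by (simp add: minus_ell2.rep_eq left_diff_distrib)
qed

text \<open>Multiplying by \<open>(n + 1)\<^sup>s\<close> and letting \<open>s \<rightarrow> \<infinity>\<close> along the integers isolates the first
  possibly nonzero coefficient.\<close>

lemma dirichlet_eval_eq_0_imp:
  assumes zero: "\<And>s. Re s > 1/2 \<Longrightarrow> dirichlet_eval f s = 0"
  shows "f = 0"
proof -
  have "coord f n = 0" for n
  proof (induction n rule: less_induct)
    case (less n)
    \<comment> \<open>The points \<open>j + 2\<close> lie in the half-plane of absolute convergence.
      Splitting off the exponent 2 makes the majorant \<open>?g\<close> summable independently of
      \<open>j\<close>.\<close>
    let ?t = "\<lambda>j k. coord f k * of_nat (Suc k) powr (- of_nat (j + 2))"
    let ?g = "\<lambda>k. cmod (coord f k) / real (Suc k) ^ 2"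
    have norm_t: "cmod (?t j k) = ?g k / real (Suc k) ^ j" for j k
    proof -
      have "cmod (of_nat (Suc k) powr (- of_nat (j + 2))) = real (Suc k) powr - real (j + 2)"
        unfolding cmod_nat_powr by simp
      also have "\<dots> = 1 / (real (Suc k) ^ 2 * real (Suc k) ^ j)"
        by (subst powr_minus, subst powr_realpow) (simp_all add: power_add field_simps power2_eq_square)
      finally show ?thesis by (simp add: norm_mult)
    qed
    have st: "summable (\<lambda>k. cmod (?t j k))" for j
      using dirichlet_abs_summable_on[of "of_nat (j + 2)" f] by (intro summable_on_imp_summable) simp
    have sg: "summable (\<lambda>k. ?g (k + Suc n))"
      using st[of 0] unfolding norm_t by (subst summable_iff_shift) simp
    define S where "S = (\<Sum>k. ?g (k + Suc n))"
    \<comment> \<open>Terms before \<open>n\<close> vanish by induction, so term \<open>n\<close> is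
      balanced by the tail, which decays in \<open>j\<close> at least like the power of base
      \<open>Suc (Suc n)\<close>. The resulting ratio is below 1.\<close>
    have bound: "?g n \<le> S * (real (Suc n) / real (Suc (Suc n))) ^ j" for j
    proof -
      have "0 = suminf (?t j)"
        using zero[of "of_nat (j + 2)"] unfolding dirichlet_eval_def by simp
      also have "\<dots> = (\<Sum>k. ?t j (k + Suc n)) + (\<Sum>k<Suc n. ?t j k)"
        by (rule suminf_split_initial_segment[OF summable_norm_cancel[OF st]])
      also have "(\<Sum>k<Suc n. ?t j k) = ?t j n" using less by simp
      finally have zero_sum: "0 = (\<Sum>k. ?t j (k + Suc n)) + ?t j n" .
      have "cmod (?t j n) = cmod (\<Sum>k. ?t j (k + Suc n))"
        unfolding minus_unique[OF zero_sum[symmetric], symmetric] norm_minus_cancel ..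
      also have "\<dots> \<le> (\<Sum>k. cmod (?t j (k + Suc n)))"
        using st[of j] by (intro summable_norm) (subst summable_iff_shift)
      also have "\<dots> \<le> (\<Sum>k. ?g (k + Suc n) / real (Suc (Suc n)) ^ j)"
      proof (rule suminf_le)
        show "cmod (?t j (k + Suc n)) \<le> ?g (k + Suc n) / real (Suc (Suc n)) ^ j" for k
          unfolding norm_t by (intro divide_left_mono power_mono) auto
        show "summable (\<lambda>k. cmod (?t j (k + Suc n)))" using st[of j] by (subst summable_iff_shift)
        show "summable (\<lambda>k. ?g (k + Suc n) / real (Suc (Suc n)) ^ j)" using sg by (rule summable_divide)
      qed
      also have "\<dots> = S / real (Suc (Suc n)) ^ j" unfolding S_def by (rule suminf_divide[OF sg])
      finally have "?g n / real (Suc n) ^ j \<le> S / real (Suc (Suc n)) ^ j" unfolding norm_t .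
      then have "?g n \<le> S / real (Suc (Suc n)) ^ j * real (Suc n) ^ j"
        by (subst (asm) pos_divide_le_eq) auto
      then show ?thesis by (simp add: power_divide)
    qed
    have "(\<lambda>j. S * (real (Suc n) / real (Suc (Suc n))) ^ j) \<longlonglongrightarrow> S * 0"
      by (intro tendsto_mult_left LIMSEQ_realpow_zero) auto
    then have "?g n \<le> S * 0" by (rule LIMSEQ_le_const) (use bound in blast)
    then show ?case by (simp add: divide_le_0_iff)
  qed
  then show ?thesis by (intro ell2_eqI) (simp add: zero_ell2.rep_eq)
qed

lemma dirichlet_eval_inject:
  assumes "\<And>s. Re s > 1/2 \<Longrightarrow> dirichlet_eval f s = dirichlet_eval g s"
  shows "f = g"
  using dirichlet_eval_eq_0_imp[of "f - g"] assms by (simp add: dirichlet_eval_diff)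

lemma composition_operator_eqI:
  assumes "\<And>f s. Re s > 1/2 \<Longrightarrow> dirichlet_eval (blinfun_apply C f) s = dirichlet_eval f (\<phi> s)"
  shows "composition_operator \<phi> = C"
  unfolding composition_operator_def
proof (rule the_equality)
  fix C' assume "\<forall>f s. 1/2 < Re s \<longrightarrow> dirichlet_eval (blinfun_apply C' f) s = dirichlet_eval f (\<phi> s)"
  then show "C' = C" using assms by (intro blinfun_eqI dirichlet_eval_inject) simp
qed (use assms in simp)

section \<open>Isometries relabelling coordinates\<close>

definition reindex_op :: "('i \<Rightarrow> 'j) \<Rightarrow> ('i ell2 \<Rightarrow>\<^sub>L 'j ell2)" where
  "reindex_op g = kernel_op (\<lambda>k i. if k = g i then 1 else 0)"

text \<open>For injective \<open>g\<close>, every row and column of the kernel contains at most one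
  entry 1, and the Schur test applies. Coordinates are transported to the range of \<open>g\<close>
  and extended by zero, so the norm is kept.\<close>

lemma
  assumes "inj g"
  shows coord_reindex_op: "coord (reindex_op g x) (g i) = coord x i" (is ?in)
    and coord_reindex_op_outside: "k \<notin> range g \<Longrightarrow> coord (reindex_op g x) k = 0" (is "_ \<Longrightarrow> ?out")
    and norm_reindex_op: "norm (reindex_op g x) = norm x" (is ?norm)
proof -
  let ?K = "\<lambda>k i. if k = g i then 1 else 0 :: complex"
  have col: "(\<Sum>k\<in>F. cmod (?K k i)) \<le> 1" if "finite F" for F i
    using that by (simp add: if_distrib[of cmod] cong: if_cong)
  have row: "(\<Sum>i\<in>G. cmod (?K k i)) \<le> 1" if "finite G" for G k
  proof (cases "k \<in> range g")
    case True
    then obtain i where "k = g i" by blast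
    then have "?K k i' = (if i = i' then 1 else 0)" for i' using injD[OF assms] by auto
    then show ?thesis using that by (simp add: if_distrib[of cmod] cong: if_cong)
  next
    case False
    then have "?K k i = 0" for i by auto
    then show ?thesis by simp
  qed
  have K: "bounded_kernel ?K (sqrt (1 * 1))"
    using col row by (intro schur_test[of "\<lambda>_. 1" "\<lambda>_. 1"]) auto
  have co: "coord (reindex_op g x) k = (\<Sum>\<^sub>\<infinity>i. ?K k i * coord x i)" for k
    unfolding reindex_op_def by (rule coord_kernel_op[OF K])
  have val: "coord (reindex_op g x) (g i) = coord x i" for i
    unfolding co by (rule trans[OF infsum_cong_neutral[where T = "{i}"]]) (auto dest: injD[OF assms])
  then show ?in .
  show out: "coord (reindex_op g x) k = 0" if "k \<notin> range g" for k
    unfolding co using that by (intro infsum_0) auto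
  have "(\<Sum>\<^sub>\<infinity>k. (cmod (coord (reindex_op g x) k))\<^sup>2) =
      (\<Sum>\<^sub>\<infinity>k\<in>range g. (cmod (coord (reindex_op g x) k))\<^sup>2)"
    by (rule infsum_cong_neutral) (auto simp: out)
  also have "\<dots> = (\<Sum>\<^sub>\<infinity>i. (cmod (coord x i))\<^sup>2)"
    by (simp add: infsum_reindex[OF assms] o_def val)
  finally show ?norm unfolding ell2_norm by simp
qed

lemma norm_isometry_compose:
  assumes "\<And>y. norm (blinfun_apply V y) = norm y"
  shows "norm (V o\<^sub>L T) = norm T"
  using assms by (simp add: norm_blinfun.rep_eq onorm_def)

section \<open>Prime monomials and the factorisation of the composition operator\<close>

definition prime_monomial :: "('d::finite \<Rightarrow> nat) \<Rightarrow> 'd multi_index \<Rightarrow> nat" where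
  "prime_monomial p \<alpha> = (\<Prod>j\<in>UNIV. p j ^ \<alpha> j)"

lemma prime_monomial_pos: "(\<And>j. prime (p j)) \<Longrightarrow> 0 < prime_monomial p \<alpha>"
  unfolding prime_monomial_def by (intro prod_pos) (simp add: prime_gt_0_nat)

text \<open>Unique factorisation: the exponents are recovered as multiplicities. Distinctness of the
  primes lets the product be rewritten over the set \<open>range p\<close>.\<close>

lemma inj_prime_monomial:
  fixes p :: "'d::finite \<Rightarrow> nat"
  assumes p: "\<And>j. prime (p j)" and inj: "inj p"
  shows "inj (prime_monomial p)"
proof -
  have mult: "multiplicity (p j) (prime_monomial p \<alpha>) = \<alpha> j" for \<alpha> j
  proof -
    have "prime_monomial p \<alpha> = (\<Prod>q\<in>range p. q ^ \<alpha> (inv p q))"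
      unfolding prime_monomial_def by (simp add: prod.reindex[OF inj] inv_f_f[OF inj])
    then show ?thesis
      using multiplicity_prod_prime_powers[of "range p" "p j" "\<lambda>q. \<alpha> (inv p q)"] p
      by (auto simp: inv_f_f[OF inj])
  qed
  show ?thesis by (rule injI) (metis mult ext)
qed

lemma prime_monomial_powr:
  assumes p: "\<And>j. prime (p j)"
  shows "of_nat (prime_monomial p \<alpha>) powr s = (\<Prod>j\<in>UNIV. (of_nat (p j) powr s :: complex) ^ \<alpha> j)"
proof -
  have powr: "of_nat m powr s = exp (s * complex_of_real (ln (real m)))" if "0 < m" for m
    using nat_powr_complex[of "m - 1" s] that by simp
  have pos: "0 < p j" for j using p[of j] by (rule prime_gt_0_nat)
  have "ln (real (prime_monomial p \<alpha>)) = (\<Sum>j\<in>UNIV. real (\<alpha> j) * ln (real (p j)))"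
    unfolding prime_monomial_def of_nat_prod of_nat_power
    using pos by (subst ln_prod) (auto simp: ln_realpow)
  then show ?thesis
    unfolding powr[OF prime_monomial_pos[OF p]] powr[OF pos]
    by (simp add: sum_distrib_left exp_sum exp_of_nat_mult[symmetric] mult_ac)
qed

text \<open>The constant part of the symbol gives the factor
  \<open>real (Suc n) powr (- 1/2 - \<delta>)\<close>; the exponential of the remaining sum expands
  into a series over multi-indices.\<close>

lemma nat_powr_symbol:
  fixes \<rho> :: "real^'d::finite"
  shows "of_nat (Suc n) powr (- symbol p \<delta> \<rho> s) =
    (\<Sum>\<^sub>\<infinity>\<alpha>. of_real (T_kernel \<delta> \<rho> \<alpha> n) * (\<Prod>j\<in>UNIV. (of_nat (p j) powr (- s)) ^ \<alpha> j))"
proof -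
  define L where "L = ln (real (Suc n))"
  define w where "w = (\<lambda>j. of_nat (p j) powr (- s) :: complex)"
  define c where "c = complex_of_real (real (Suc n) powr (- 1/2 - \<delta>))"
  have "of_nat (Suc n) powr (- symbol p \<delta> \<rho> s) =
      exp (complex_of_real ((- 1/2 - \<delta>) * L) + (\<Sum>j\<in>UNIV. complex_of_real (- \<delta> * L * \<rho> $ j) * w j))"
    unfolding nat_powr_complex symbol_def L_def[symmetric] w_def
    by (intro arg_cong[of _ _ exp])
      (simp add: algebra_simps sum_distrib_left sum_distrib_right sum_negf)
  also have "\<dots> = c * exp (\<Sum>j\<in>UNIV. complex_of_real (- \<delta> * L * \<rho> $ j) * w j)"
    unfolding exp_add c_def L_def powr_def by (simp flip: exp_of_real)
  also have "\<dots> = (\<Sum>\<^sub>\<infinity>\<alpha>. c * (\<Prod>j\<in>UNIV. (complex_of_real (- \<delta> * L * \<rho> $ j) * w j) ^ \<alpha> j / fact (\<alpha> j)))"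
    unfolding infsum_multi_exp[symmetric] infsum_cmult_right' ..
  also have "\<dots> = (\<Sum>\<^sub>\<infinity>\<alpha>. of_real (T_kernel \<delta> \<rho> \<alpha> n) * (\<Prod>j\<in>UNIV. w j ^ \<alpha> j))"
  proof (rule infsum_cong)
    fix \<alpha> :: "'d multi_index"
    have factor: "(complex_of_real x * u) ^ k / fact k = complex_of_real (x ^ k / fact k) * u ^ k" for x u k
      by (simp add: power_mult_distrib)
    have "(\<Prod>j\<in>UNIV. (complex_of_real (- \<delta> * L * \<rho> $ j) * w j) ^ \<alpha> j / fact (\<alpha> j)) =
        (\<Prod>j\<in>UNIV. complex_of_real ((- \<delta> * L * \<rho> $ j) ^ \<alpha> j / fact (\<alpha> j)) * w j ^ \<alpha> j)"
      by (intro prod.cong refl factor)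
    also have "\<dots> = complex_of_real ((- \<delta> * L) ^ mi_abs \<alpha> * mi_power \<rho> \<alpha> / mi_fact \<alpha>) * (\<Prod>j\<in>UNIV. w j ^ \<alpha> j)"
      unfolding mi_monomial prod.distrib of_real_prod ..
    finally show "c * (\<Prod>j\<in>UNIV. (complex_of_real (- \<delta> * L * \<rho> $ j) * w j) ^ \<alpha> j / fact (\<alpha> j)) =
        of_real (T_kernel \<delta> \<rho> \<alpha> n) * (\<Prod>j\<in>UNIV. w j ^ \<alpha> j)"
      unfolding T_kernel_def c_def L_def by (simp only: of_real_mult mult.assoc)
  qed
  finally show ?thesis unfolding w_def .
qed

text \<open>The shift by 1 matches the convention that coordinate \<open>n\<close> holds the
  coefficient of index \<open>Suc n\<close>; prime monomials are positive, so the truncated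
  subtraction is exact.\<close>

lemma dirichlet_eval_reindex_prime_monomial:
  fixes p :: "'d::finite \<Rightarrow> nat"
  assumes p: "\<And>j. prime (p j)" and inj: "inj p" and s: "Re s > 1/2"
  shows "dirichlet_eval (reindex_op (\<lambda>\<alpha>. prime_monomial p \<alpha> - 1) y) s =
    (\<Sum>\<^sub>\<infinity>\<alpha>. coord y \<alpha> * (\<Prod>j\<in>UNIV. (of_nat (p j) powr (- s)) ^ \<alpha> j))"
proof -
  let ?g = "\<lambda>\<alpha>. prime_monomial p \<alpha> - 1"
  have Suc_g: "Suc (?g \<alpha>) = prime_monomial p \<alpha>" for \<alpha>
    using prime_monomial_pos[of p \<alpha>, OF p] by simp
  have g: "inj ?g" by (rule injI) (metis Suc_g injD[OF inj_prime_monomial[OF p inj]])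
  have "dirichlet_eval (reindex_op ?g y) s =
      (\<Sum>\<^sub>\<infinity>n\<in>range ?g. coord (reindex_op ?g y) n * of_nat (Suc n) powr (- s))"
    unfolding dirichlet_eval_infsum[OF s]
    by (rule infsum_cong_neutral) (auto simp: coord_reindex_op_outside[OF g] simp del: One_nat_def)
  also have "\<dots> = (\<Sum>\<^sub>\<infinity>\<alpha>. coord y \<alpha> * of_nat (prime_monomial p \<alpha>) powr (- s))"
    unfolding infsum_reindex[OF g] o_def coord_reindex_op[OF g] Suc_g ..
  finally show ?thesis unfolding prime_monomial_powr[OF p] .
qed

text \<open>By injectivity the family is a subfamily of the square-summable powers of the positive
  integers.\<close>

lemma prime_monomial_square_summable:
  fixes p :: "'d::finite \<Rightarrow> nat"
  assumes p: "\<And>j. prime (p j)" and inj: "inj p" and s: "Re s > 1/2"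
  shows "(\<lambda>\<alpha>. (cmod (\<Prod>j\<in>UNIV. (of_nat (p j) powr (- s)) ^ \<alpha> j))\<^sup>2) summable_on UNIV"
proof -
  let ?g = "\<lambda>\<alpha>. prime_monomial p \<alpha> - 1"
  have Suc_g: "Suc (?g \<alpha>) = prime_monomial p \<alpha>" for \<alpha>
    using prime_monomial_pos[of p \<alpha>, OF p] by simp
  have g: "inj ?g" by (rule injI) (metis Suc_g injD[OF inj_prime_monomial[OF p inj]])
  have "(\<lambda>n. (cmod (of_nat (Suc n) powr (- s)))\<^sup>2) summable_on range ?g"
    by (rule summable_on_subset_banach[OF nat_powr_square_summable[OF s]]) simp
  then have "(\<lambda>\<alpha>. (cmod (of_nat (prime_monomial p \<alpha>) powr (- s)))\<^sup>2) summable_on UNIV"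
    unfolding summable_on_reindex[OF g] o_def Suc_g .
  then show ?thesis unfolding prime_monomial_powr[OF p] .
qed

text \<open>Both sides are iterated sums of the double family \<open>F\<close>: summing over
  \<open>\<alpha>\<close> first gives the series evaluated at the symbol, summing over
  \<open>n\<close> first gives the coefficients of the image under the coefficient operator.\<close>

lemma composition_operator_eq:
  fixes p :: "'d::finite \<Rightarrow> nat"
  assumes p: "\<And>j. prime (p j)" and inj: "inj p" and \<rho>: "\<rho> \<in> B_set" and \<delta>: "0 < \<delta>"
  shows "composition_operator (symbol p \<delta> \<rho>) =
    reindex_op (\<lambda>\<alpha>. prime_monomial p \<alpha> - 1) o\<^sub>L coeff_operator \<delta> \<rho>"
proof (rule composition_operator_eqI)
  fix f s assume s: "Re s > 1/2"
  note T = bounded_T_kernel[OF \<rho> \<delta>]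
  define z where "z = (\<lambda>\<alpha>. \<Prod>j\<in>UNIV. (of_nat (p j) powr (- s) :: complex) ^ \<alpha> j)"
  define F where "F = (\<lambda>\<alpha> n. complex_of_real (T_kernel \<delta> \<rho> \<alpha> n) * coord f n * z \<alpha>)"
  have "(\<lambda>(\<alpha>, n). complex_of_real (T_kernel \<delta> \<rho> \<alpha> n) * coord f n * cnj (cnj (z \<alpha>))) summable_on UNIV \<times> UNIV"
    using prime_monomial_square_summable[OF p inj s]
    by (intro bounded_kernel_summable[OF T] coord_cmod_summable) (simp only: complex_mod_cnj z_def)
  then have F: "(\<lambda>(\<alpha>, n). F \<alpha> n) summable_on UNIV \<times> UNIV" by (simp add: F_def)
  have F': "(\<lambda>(n, \<alpha>). F \<alpha> n) summable_on UNIV \<times> UNIV"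
    using F summable_on_swap[of "\<lambda>(\<alpha>, n). F \<alpha> n" UNIV UNIV] by (simp add: split_def)
  have inner: "(\<Sum>\<^sub>\<infinity>\<alpha>. F \<alpha> n) = coord f n * of_nat (Suc n) powr (- symbol p \<delta> \<rho> s)" for n
    unfolding nat_powr_symbol F_def infsum_cmult_right'[symmetric]
    by (simp add: mult_ac z_def)
  \<comment> \<open>Convergence at the point \<open>symbol p \<delta> \<rho> s\<close> is read off
    from the summable double family.\<close>
  have "(\<lambda>n. coord f n * of_nat (Suc n) powr (- symbol p \<delta> \<rho> s)) summable_on UNIV"
    using summable_on_Sigma_banach[OF F'] unfolding inner .
  from has_sum_imp_sums[OF has_sum_infsum[OF this]]
  have "dirichlet_eval f (symbol p \<delta> \<rho> s) = (\<Sum>\<^sub>\<infinity>n. \<Sum>\<^sub>\<infinity>\<alpha>. F \<alpha> n)"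
    unfolding dirichlet_eval_def inner by (simp only: sums_iff)
  also have "\<dots> = (\<Sum>\<^sub>\<infinity>\<alpha>. \<Sum>\<^sub>\<infinity>n. F \<alpha> n)" by (rule infsum_swap_banach[OF F'])
  also have "\<dots> = (\<Sum>\<^sub>\<infinity>\<alpha>. coord (coeff_operator \<delta> \<rho> f) \<alpha> * z \<alpha>)"
    unfolding F_def infsum_cmult_left' coeff_operator_eq[OF \<rho> \<delta>] coord_kernel_op[OF T] ..
  also have "\<dots> = dirichlet_eval (reindex_op (\<lambda>\<alpha>. prime_monomial p \<alpha> - 1) (coeff_operator \<delta> \<rho> f)) s"
    unfolding dirichlet_eval_reindex_prime_monomial[OF p inj s] z_def ..
  finally show "dirichlet_eval (blinfun_apply
      (reindex_op (\<lambda>\<alpha>. prime_monomial p \<alpha> - 1) o\<^sub>L coeff_operator \<delta> \<rho>) f) s =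
    dirichlet_eval f (symbol p \<delta> \<rho> s)" by simp
qed

lemma norm_composition_operator:
  fixes p :: "'d::finite \<Rightarrow> nat"
  assumes p: "\<And>j. prime (p j)" and inj: "inj p" and \<rho>: "\<rho> \<in> B_set" and \<delta>: "0 < \<delta>"
  shows "(norm (composition_operator (symbol p \<delta> \<rho>)))\<^sup>2 = norm (A_operator \<delta> \<rho>)"
proof -
  have "inj (\<lambda>\<alpha>. prime_monomial p \<alpha> - 1)"
    using injD[OF inj_prime_monomial[OF p inj]] prime_monomial_pos[of p, OF p]
    by (intro injI) (metis Suc_pred')
  then show ?thesis
    unfolding composition_operator_eq[OF p inj \<rho> \<delta>] norm_A_operator[OF \<rho> \<delta>]
    by (simp add: norm_isometry_compose norm_reindex_op)
qed

theorem theorem3p4: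
  fixes p :: "'d::finite \<Rightarrow> nat" and \<eta> :: real
  assumes "\<And>j. prime (p j)" and "inj p" and "\<eta> > 0"
  shows "\<exists>C::real. C > 0 \<and>
    (\<forall>\<delta>. 0 < \<delta> \<and> \<delta> \<le> \<eta> \<longrightarrow>
      (SUP \<rho>\<in>(B_set :: (real^'d) set).
        ereal (norm ((2 * \<delta>) *\<^sub>R A_operator \<delta> \<rho> - H_operator \<rho>))) \<le> ereal (C * \<delta>)) \<and>
    (\<forall>\<delta>. 0 < \<delta> \<and> \<delta> \<le> \<eta> \<longrightarrow>
      (SUP \<rho>\<in>(B_set :: (real^'d) set).
        ereal \<bar>2 * \<delta> * (norm (composition_operator (symbol p \<delta> \<rho>)))\<^sup>2 - norm (H_operator \<rho>)\<bar>)
      \<le> ereal (C * \<delta>))"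
proof (intro exI[of _ 8] conjI allI impI)
  fix \<delta> assume "0 < \<delta> \<and> \<delta> \<le> \<eta>"
  then have \<delta>: "0 < \<delta>" by simp
  show "(SUP \<rho>\<in>(B_set :: (real^'d) set).
      ereal (norm ((2 * \<delta>) *\<^sub>R A_operator \<delta> \<rho> - H_operator \<rho>))) \<le> ereal (8 * \<delta>)"
    by (rule SUP_least) (simp add: norm_A_operator_minus_H_operator_le \<delta>)
  show "(SUP \<rho>\<in>(B_set :: (real^'d) set).
      ereal \<bar>2 * \<delta> * (norm (composition_operator (symbol p \<delta> \<rho>)))\<^sup>2 - norm (H_operator \<rho>)\<bar>)
      \<le> ereal (8 * \<delta>)"
  proof (rule SUP_least)
    fix \<rho> :: "real^'d" assume \<rho>: "\<rho> \<in> B_set"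
    \<comment> \<open>The squared norm is that of \<open>A_operator\<close>, so the reverse triangle
      inequality transfers the first estimate with the same constant.\<close>
    have "\<bar>2 * \<delta> * (norm (composition_operator (symbol p \<delta> \<rho>)))\<^sup>2 - norm (H_operator \<rho>)\<bar> =
        \<bar>norm ((2 * \<delta>) *\<^sub>R A_operator \<delta> \<rho>) - norm (H_operator \<rho>)\<bar>"
      using \<delta> by (simp add: norm_composition_operator[OF assms(1,2) \<rho> \<delta>])
    also have "\<dots> \<le> norm ((2 * \<delta>) *\<^sub>R A_operator \<delta> \<rho> - H_operator \<rho>)" by (rule norm_triangle_ineq3)
    also have "\<dots> \<le> 8 * \<delta>" by (rule norm_A_operator_minus_H_operator_le[OF \<rho> \<delta>])
    finally show "ereal \<bar>2 * \<delta> * (norm (composition_operator (symbol p \<delta> \<rho>)))\<^sup>2 - norm (H_operator \<rho>)\<bar>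
        \<le> ereal (8 * \<delta>)" by simp
  qed
qed simp

end
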